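(* Let $P$ be a poset with no infinite antichain and $\alpha$ a countable ordinal. The following are equivalent: (i) $P$ is $\alpha$-bqo; (ii) $(P;\leq_{succ})$ is $\alpha$-bqo; (iii) $(P;\leq_{pred})$ is $\alpha$-bqo; (iv) $(P;\leq_{crit})$ is $\alpha$-bqo; (v) $AM(P)$ is $\alpha$-bqo.
   Context: For $a,b\in P$: $a\leq_{pred} b$ iff every $x\in P$ with $x<a$ satisfies $x<b$; $a\leq_{succ} b$ iff every $y\in P$ with $b<y$ satisfies $a<y$; $a\leq_{crit} b$ iff both $a\leq_{pred} b$ and $a\leq_{succ} b$. These are quasi-orders on $P$. $AM(P)$ is the set of maximal antichains of $P$, ordered by domination: $X\leq Y$ iff for every $x\in X$ there is $y\in Y$ with $x\leq y$. Barriers and $\alpha$-bqo: finite subsets of $\mathbb{N}$ are identified with their increasing enumerations. For finite $s,t\subseteq\mathbb{N}$ write $s\triangleleft t$ if there is a finite $r\subseteq\mathbb{N}$ such that $s$ is a proper initial segment of $r$ and $t$ is $r$ with its least element removed. A barrier is an infinite set $B$ of finite subsets of $\mathbb{N}$, no member of which is a proper subset of another, such that every infinite $X\subseteq\bigcup B$ has a nonempty initial segment belonging to $B$. A barrier is well-ordered by the lexicographic order; its order type is the type of this well-order. A map $f$ from a barrier $B$ into a quasi-ordered set $Q$ is good if there exist $s,t\in B$ with $s\triangleleft t$ and $f(s)\leq f(t)$, and bad otherwise. $Q$ is $\alpha$-bqo if every map from a barrier of order type at most $\alpha$ into $Q$ is good. *)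

theory Defs
  imports Main "HOL-Library.Countable_Set"
begin

definition poset_on :: "'p set \<Rightarrow> ('p \<Rightarrow> 'p \<Rightarrow> bool) \<Rightarrow> bool" where
  "poset_on P le \<longleftrightarrow>
     (\<forall>x\<in>P. le x x) \<and>
     (\<forall>x\<in>P. \<forall>y\<in>P. le x y \<and> le y x \<longrightarrow> x = y) \<and>
     (\<forall>x\<in>P. \<forall>y\<in>P. \<forall>z\<in>P. le x y \<and> le y z \<longrightarrow> le x z)"

definition strict :: "('p \<Rightarrow> 'p \<Rightarrow> bool) \<Rightarrow> 'p \<Rightarrow> 'p \<Rightarrow> bool" where
  "strict le x y \<longleftrightarrow> le x y \<and> x \<noteq> y"

definition le_pred :: "'p set \<Rightarrow> ('p \<Rightarrow> 'p \<Rightarrow> bool) \<Rightarrow> 'p \<Rightarrow> 'p \<Rightarrow> bool" where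
  "le_pred P le a b \<longleftrightarrow> (\<forall>x\<in>P. strict le x a \<longrightarrow> strict le x b)"

definition le_succ :: "'p set \<Rightarrow> ('p \<Rightarrow> 'p \<Rightarrow> bool) \<Rightarrow> 'p \<Rightarrow> 'p \<Rightarrow> bool" where
  "le_succ P le a b \<longleftrightarrow> (\<forall>y\<in>P. strict le b y \<longrightarrow> strict le a y)"

definition le_crit :: "'p set \<Rightarrow> ('p \<Rightarrow> 'p \<Rightarrow> bool) \<Rightarrow> 'p \<Rightarrow> 'p \<Rightarrow> bool" where
  "le_crit P le a b \<longleftrightarrow> le_pred P le a b \<and> le_succ P le a b"

definition antichain_in :: "'p set \<Rightarrow> ('p \<Rightarrow> 'p \<Rightarrow> bool) \<Rightarrow> 'p set \<Rightarrow> bool" where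
  "antichain_in P le A \<longleftrightarrow> A \<subseteq> P \<and> (\<forall>x\<in>A. \<forall>y\<in>A. x \<noteq> y \<longrightarrow> \<not> le x y)"

definition max_antichain_in :: "'p set \<Rightarrow> ('p \<Rightarrow> 'p \<Rightarrow> bool) \<Rightarrow> 'p set \<Rightarrow> bool" where
  "max_antichain_in P le A \<longleftrightarrow> antichain_in P le A \<and>
     (\<forall>B. antichain_in P le B \<and> A \<subseteq> B \<longrightarrow> B = A)"

definition AM :: "'p set \<Rightarrow> ('p \<Rightarrow> 'p \<Rightarrow> bool) \<Rightarrow> 'p set set" where
  "AM P le = {A. max_antichain_in P le A}"

definition dom_le :: "('p \<Rightarrow> 'p \<Rightarrow> bool) \<Rightarrow> 'p set \<Rightarrow> 'p set \<Rightarrow> bool" where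
  "dom_le le X Y \<longleftrightarrow> (\<forall>x\<in>X. \<exists>y\<in>Y. le x y)"

definition init_seg :: "nat set \<Rightarrow> nat set \<Rightarrow> bool" where
  "init_seg s X \<longleftrightarrow> finite s \<and> s \<subseteq> X \<and> (\<forall>x\<in>X. \<forall>y\<in>s. x \<le> y \<longrightarrow> x \<in> s)"

definition barrier :: "nat set set \<Rightarrow> bool" where
  "barrier B \<longleftrightarrow> infinite B \<and> (\<forall>s\<in>B. finite s) \<and>
     (\<forall>s\<in>B. \<forall>t\<in>B. \<not> s \<subset> t) \<and>
     (\<forall>X. X \<subseteq> \<Union>B \<and> infinite X \<longrightarrow> (\<exists>s\<in>B. s \<noteq> {} \<and> init_seg s X))"

definition tri :: "nat set \<Rightarrow> nat set \<Rightarrow> bool" where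
  "tri s t \<longleftrightarrow> (\<exists>r. finite r \<and> r \<noteq> {} \<and> init_seg s r \<and> s \<noteq> r \<and> t = r - {Min r})"

definition lex_barrier :: "nat set set \<Rightarrow> nat set rel" where
  "lex_barrier B = {(s, t). s \<in> B \<and> t \<in> B \<and>
     (s = t \<or> (sorted_list_of_set s, sorted_list_of_set t) \<in> lexord {(x, y). x < y})}"

definition good_map :: "nat set set \<Rightarrow> ('q \<Rightarrow> 'q \<Rightarrow> bool) \<Rightarrow> (nat set \<Rightarrow> 'q) \<Rightarrow> bool" where
  "good_map B leq f \<longleftrightarrow> (\<exists>s\<in>B. \<exists>t\<in>B. tri s t \<and> leq (f s) (f t))"

text \<open>Q is alpha-bqo, where the countable ordinal alpha is given by a well-order relation.\<close>
definition alpha_bqo :: "'a rel \<Rightarrow> 'q set \<Rightarrow> ('q \<Rightarrow> 'q \<Rightarrow> bool) \<Rightarrow> bool" where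
  "alpha_bqo \<alpha> Q leq \<longleftrightarrow>
     (\<forall>B f. barrier B \<and> (lex_barrier B, \<alpha>) \<in> ordLeq \<and> f ` B \<subseteq> Q \<longrightarrow> good_map B leq f)"

end

theory Submission
  imports Defs
begin

text \<open>
  A map \<open>f\<close> on a barrier \<open>B\<close> is viewed as a continuous map \<open>F\<close> on infinite sets \<open>A\<close>, namely the
  value of \<open>f\<close> at the initial segment of \<open>A\<close> in \<open>B\<close>. Let \<open>m A\<close> be the last element of the shortest
  initial segment of \<open>A\<close> that determines \<open>F A\<close>. Suppose \<open>f\<close> is bad for \<open>\<le>\<close>. By the clopen Ramsey
  theorem we may assume that \<open>m\<close> increases when the least element is removed and that
  \<open>F A < F (A - {m A})\<close> always: equality contradicts the choice of \<open>m\<close>, incomparability yields an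
  infinite antichain, and \<open>>\<close> an infinite descending chain, which is bad for all the orders at hand.
  Setting \<open>g s = F (A - {m A})\<close> for a canonical \<open>A\<close> extending \<open>s\<close> gives \<open>f s < g s\<close> but not
  \<open>f s \<le> g t\<close> whenever \<open>s \<triangleleft> t\<close>. So \<open>f\<close> is bad for \<open>\<le>\<^sub>s\<^sub>u\<^sub>c\<^sub>c\<close> and \<open>g\<close> is bad for \<open>\<le>\<^sub>p\<^sub>r\<^sub>e\<^sub>d\<close>, both on
  a restriction of \<open>B\<close>, whose order type is not larger.

  For well-founded \<open>P\<close>, sending \<open>a\<close> to \<open>a\<close> together with the minimal elements incomparable to \<open>a\<close>
  reflects domination of maximal antichains to \<open>\<le>\<^sub>p\<^sub>r\<^sub>e\<^sub>d\<close>. Conversely, maximal antichains are finite, so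
  for a bad map into them fusion selects for each \<open>s\<close> one element that witnesses badness against
  all \<open>t\<close> with \<open>s \<triangleleft> t\<close>.
\<close>

section \<open>Infinite sets of natural numbers\<close>

definition infsets :: "nat set \<Rightarrow> nat set set" where
  "infsets U = {A. A \<subseteq> U \<and> infinite A}"

definition beyond :: "nat set \<Rightarrow> nat set \<Rightarrow> nat set" where
  "beyond u X = {x \<in> X. \<forall>y\<in>u. y < x}"

text \<open>Infinite counterpart of the passage from \<open>r\<close> to \<open>t\<close> in
  \<open>tri\<close>: badness of a map on a barrier becomes a condition comparing the values at
  \<open>A\<close> and at \<open>shift A\<close>.\<close>

definition shift :: "nat set \<Rightarrow> nat set" where
  "shift A = A - {Inf A}"

text \<open>Continuity on the space of infinite subsets of \<open>U\<close>, with a discrete codomain.\<close>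

definition locally_constant :: "nat set \<Rightarrow> (nat set \<Rightarrow> 'c) \<Rightarrow> bool" where
  "locally_constant U c \<longleftrightarrow>
     (\<forall>A\<in>infsets U. \<exists>k. \<forall>A'\<in>infsets U. A' \<inter> {..k} = A \<inter> {..k} \<longrightarrow> c A' = c A)"

lemma infsets_mono: "A \<in> infsets Y \<Longrightarrow> Y \<subseteq> X \<Longrightarrow> A \<in> infsets X"
  by (auto simp: infsets_def)

lemma infsets_trans: "A \<in> infsets Y \<Longrightarrow> Y \<in> infsets X \<Longrightarrow> A \<in> infsets X"
  by (auto simp: infsets_def)

lemma beyond_subset: "beyond u X \<subseteq> X"
  by (auto simp: beyond_def)

lemma beyond_mono: "Y \<subseteq> X \<Longrightarrow> beyond u Y \<subseteq> beyond u X"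
  by (auto simp: beyond_def)

lemma beyond_infinite:
  assumes "finite u" "infinite X"
  shows "infinite (beyond u X)"
proof -
  obtain k where k: "\<forall>y\<in>u. y \<le> k"
    using assms(1) finite_nat_set_iff_bounded_le by blast
  have "X - {..k} \<subseteq> beyond u X" using k by (fastforce simp: beyond_def)
  moreover have "infinite (X - {..k})" using assms(2) by simp
  ultimately show ?thesis using finite_subset by blast
qed

lemma beyond_infsets: "finite u \<Longrightarrow> X \<in> infsets U \<Longrightarrow> beyond u X \<in> infsets U"
  using beyond_infinite[of u X] beyond_subset[of u X] by (auto simp: infsets_def)

lemma Inf_in_infsets: "A \<in> infsets U \<Longrightarrow> Inf A \<in> A"
  by (rule Inf_nat_def1) (auto simp: infsets_def)

lemma Inf_nat_le: "(x::nat) \<in> A \<Longrightarrow> Inf A \<le> x"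
  by (rule cInf_lower) auto

lemma shift_infsets: "A \<in> infsets U \<Longrightarrow> shift A \<in> infsets U"
  by (auto simp: infsets_def shift_def)

lemma shift_beyond: "shift A = beyond {Inf A} A"
proof
  show "shift A \<subseteq> beyond {Inf A} A"
    using Inf_nat_le[of _ A] by (auto simp: shift_def beyond_def order.strict_iff_order)
qed (auto simp: shift_def beyond_def)

lemma Inf_cut:
  fixes A :: "nat set"
  assumes "A \<noteq> {}" "Inf A \<le> k" "A' \<inter> {..k} = A \<inter> {..k}"
  shows "Inf A' = Inf A"
proof -
  have "Inf A \<in> A \<inter> {..k}" using Inf_nat_def1[OF assms(1)] assms(2) by simp
  then have a: "Inf A \<in> A'" unfolding assms(3)[symmetric] by simp
  then have "A' \<noteq> {}" "Inf A' \<le> Inf A" by (auto intro: Inf_nat_le)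
  then have "Inf A' \<in> A'" by (simp add: Inf_nat_def1)
  then have "Inf A' \<in> A' \<inter> {..k}" using assms(2) \<open>Inf A' \<le> Inf A\<close> by simp
  then have "Inf A' \<in> A" using assms(3) by simp
  then show ?thesis using Inf_nat_le \<open>Inf A' \<le> Inf A\<close> by (simp add: antisym)
qed

lemma shift_cut:
  fixes A :: "nat set"
  assumes "A \<noteq> {}" "Inf A \<le> k" "A' \<inter> {..k} = A \<inter> {..k}"
  shows "shift A' \<inter> {..k} = shift A \<inter> {..k}"
proof -
  have "shift B \<inter> {..k} = B \<inter> {..k} - {Inf B}" for B by (auto simp: shift_def)
  then show ?thesis by (simp only: Inf_cut[OF assms] assms(3))
qed

text \<open>A modulus of continuity may be enlarged freely, so it can be taken above any prescribed
  \<open>l\<close>, such as the least element of a set or another modulus.\<close>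

lemma locally_constantE:
  assumes "locally_constant U c" "A \<in> infsets U"
  obtains k where "k \<ge> l"
    "\<And>A'. A' \<in> infsets U \<Longrightarrow> A' \<inter> {..k} = A \<inter> {..k} \<Longrightarrow> c A' = c A"
proof -
  obtain k where k: "\<forall>A'\<in>infsets U. A' \<inter> {..k} = A \<inter> {..k} \<longrightarrow> c A' = c A"
    using assms unfolding locally_constant_def by meson
  have "c A' = c A"
    if "A' \<in> infsets U" "A' \<inter> {..max k l} = A \<inter> {..max k l}" for A'
  proof -
    have "A' \<inter> {..k} = A' \<inter> {..max k l} \<inter> {..k}" "A \<inter> {..k} = A \<inter> {..max k l} \<inter> {..k}"
      by auto
    then have "A' \<inter> {..k} = A \<inter> {..k}" using that(2) by simp
    then show ?thesis using k that(1) by blast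
  qed
  then show ?thesis by (intro that[of "max k l"]) simp_all
qed

section \<open>Closure properties of locally constant maps\<close>

lemma locally_constant_subset:
  "locally_constant U c \<Longrightarrow> V \<subseteq> U \<Longrightarrow> locally_constant V c"
  unfolding locally_constant_def
  by (intro ballI) (drule bspec, erule (1) infsets_mono, erule exE, rule exI, auto intro: infsets_mono)

lemma locally_constant_pair:
  assumes "locally_constant U c" "locally_constant U d"
  shows "locally_constant U (\<lambda>A. h (c A) (d A))"
  unfolding locally_constant_def
proof
  fix A assume A: "A \<in> infsets U"
  obtain k where k: "\<And>A'. A' \<in> infsets U \<Longrightarrow> A' \<inter> {..k} = A \<inter> {..k} \<Longrightarrow> c A' = c A"
    using locally_constantE[OF assms(1) A, of 0] by blast
  obtain l where l: "l \<ge> k" "\<And>A'. A' \<in> infsets U \<Longrightarrow> A' \<inter> {..l} = A \<inter> {..l} \<Longrightarrow> d A' = d A"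
    using locally_constantE[OF assms(2) A, of k] by blast
  have "h (c A') (d A') = h (c A) (d A)"
    if "A' \<in> infsets U" "A' \<inter> {..l} = A \<inter> {..l}" for A'
  proof -
    have "A' \<inter> {..k} = A \<inter> {..k}" using that(2) l(1) by fastforce
    then show ?thesis using that k l by metis
  qed
  then show "\<exists>k. \<forall>A'\<in>infsets U. A' \<inter> {..k} = A \<inter> {..k} \<longrightarrow> h (c A') (d A') = h (c A) (d A)"
    by blast
qed

lemma locally_constant_comp:
  "locally_constant U c \<Longrightarrow> locally_constant U (\<lambda>A. h (c A))"
  by (rule locally_constant_pair)

lemma locally_constant_shift:
  assumes "locally_constant U c"
  shows "locally_constant U (\<lambda>A. c (shift A))"
  unfolding locally_constant_def
proof
  fix A assume A: "A \<in> infsets U"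
  obtain k where k: "k \<ge> Inf A"
    "\<And>A'. A' \<in> infsets U \<Longrightarrow> A' \<inter> {..k} = shift A \<inter> {..k} \<Longrightarrow> c A' = c (shift A)"
    using locally_constantE[OF assms shift_infsets[OF A]] by blast
  have "A \<noteq> {}" using A by (auto simp: infsets_def)
  then have "\<forall>A'\<in>infsets U. A' \<inter> {..k} = A \<inter> {..k} \<longrightarrow> c (shift A') = c (shift A)"
    using k(2)[OF shift_infsets shift_cut[OF _ k(1)]] by simp
  then show "\<exists>k. \<forall>A'\<in>infsets U. A' \<inter> {..k} = A \<inter> {..k} \<longrightarrow> c (shift A') = c (shift A)"
    by blast
qed

text \<open>Makes a colouring of the infinite continuations \<open>A\<close> of a fixed finite stem
  \<open>u\<close> continuous in \<open>A\<close>.\<close>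

lemma locally_constant_union:
  assumes "locally_constant U c" "u \<subseteq> U" "finite u"
  shows "locally_constant U (\<lambda>A. c (u \<union> A))"
  unfolding locally_constant_def
proof
  fix A assume A: "A \<in> infsets U"
  have u: "u \<union> A \<in> infsets U" if "A \<in> infsets U" for A
    using that assms(2) by (auto simp: infsets_def)
  obtain k where k: 
    "\<And>A'. A' \<in> infsets U \<Longrightarrow> A' \<inter> {..k} = (u \<union> A) \<inter> {..k} \<Longrightarrow> c A' = c (u \<union> A)"
    using locally_constantE[OF assms(1) u[OF A]] by blast
  then have "\<forall>A'\<in>infsets U. A' \<inter> {..k} = A \<inter> {..k} \<longrightarrow> c (u \<union> A') = c (u \<union> A)"
    using u by (metis Int_Un_distrib2)
  then show "\<exists>k. \<forall>A'\<in>infsets U. A' \<inter> {..k} = A \<inter> {..k} \<longrightarrow> c (u \<union> A') = c (u \<union> A)"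
    by blast
qed

section \<open>Fusion and the clopen Ramsey theorem\<close>

text \<open>\<open>D u Y\<close> is a hereditary property of a finite stem \<open>u\<close> and a
  reservoir \<open>Y\<close> that can be reached by shrinking \<open>Y\<close>. A decreasing
  sequence of reservoirs settles more and more stems, and the set of their minima serves all its
  finite subsets at once. Only the tail beyond \<open>u\<close> lies in the reservoir that settled
  \<open>u\<close>, hence \<open>beyond u Y\<close>.\<close>

lemma fusion:
  assumes mono: "\<And>u Y Z. D u Y \<Longrightarrow> Z \<in> infsets Y \<Longrightarrow> D u Z"
    and dense: "\<And>u Y. finite u \<Longrightarrow> u \<subseteq> X \<Longrightarrow> Y \<in> infsets X \<Longrightarrow> \<exists>Z\<in>infsets Y. D u Z"
    and X: "infinite X"
  obtains Y where "Y \<in> infsets X" "\<And>u. finite u \<Longrightarrow> u \<subseteq> Y \<Longrightarrow> D u (beyond u Y)"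
proof -
  have fin: "\<exists>Z\<in>infsets Y. \<forall>u\<in>K. D u Z"
    if "finite K" "\<forall>u\<in>K. finite u \<and> u \<subseteq> X" "Y \<in> infsets X" for K Y
    using that
  proof (induction K arbitrary: Y rule: finite_induct)
    case empty
    then show ?case by (auto simp: infsets_def)
  next
    case (insert u K)
    obtain Z where Z: "Z \<in> infsets Y" "\<forall>u\<in>K. D u Z"
      using insert.IH[of Y] insert.prems by auto
    obtain W where "W \<in> infsets Z" "D u W"
      using dense[of u Z] insert.prems infsets_trans[OF Z(1)] by auto
    then show ?case
      using Z(2) mono infsets_trans[OF _ Z(1)] by (intro bexI[of _ W]) auto
  qed
  \<comment> \<open>Only finitely many stems are bounded by the least element of \<open>Z\<close>,
    so \<open>fin\<close> settles all of them in one step.\<close>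
  define step where "step Z W \<longleftrightarrow> W \<in> infsets (shift Z) \<and>
    (\<forall>u. u \<subseteq> {..Inf Z} \<inter> X \<longrightarrow> D u W)" for Z W
  define h where "h Z = (SOME W. step Z W)" for Z
  have h: "step Z (h Z)" if "Z \<in> infsets X" for Z
  proof -
    have "\<exists>W\<in>infsets (shift Z). \<forall>u\<in>Pow ({..Inf Z} \<inter> X). D u W"
      using shift_infsets[OF that] by (intro fin) (auto intro: finite_subset)
    then have "\<exists>W. step Z W" unfolding step_def by auto
    then show ?thesis unfolding h_def by (rule someI_ex)
  qed
  \<comment> \<open>The empty stem is settled before the first minimum is taken, because
    \<open>beyond {} (range x)\<close> is all of \<open>range x\<close>.\<close>
  obtain X0 where X0: "X0 \<in> infsets X" "D {} X0"
    using dense[of "{}" X] X by (auto simp: infsets_def)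
  define Xs where "Xs n = (h ^^ n) X0" for n
  have Xs_Suc: "Xs (Suc n) = h (Xs n)" for n by (simp add: Xs_def)
  have Xs: "Xs n \<in> infsets X" for n
  proof (induction n)
    case 0
    then show ?case using X0 by (simp add: Xs_def)
  next
    case (Suc n)
    then show ?case
      using h[OF Suc] infsets_trans[OF _ shift_infsets[OF Suc]]
      unfolding step_def Xs_Suc by simp
  qed
  have stepn: "step (Xs n) (Xs (Suc n))" for n
    using h[OF Xs[of n]] by (simp add: Xs_Suc)
  have dec1: "Xs (Suc n) \<subseteq> shift (Xs n)" for n
    using stepn[of n] by (auto simp: step_def infsets_def)
  have "Xs (Suc n) \<subseteq> Xs n" for n using dec1[of n] by (auto simp: shift_def)
  then have dec: "Xs n \<subseteq> Xs m" if "m \<le> n" for m n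
    using that by (rule lift_Suc_antimono_le)
  define x where "x n = Inf (Xs n)" for n
  have x: "x n \<in> Xs n" for n using Inf_in_infsets[OF Xs] by (simp add: x_def)
  have "x n < x (Suc n)" for n
  proof -
    have "x (Suc n) \<in> shift (Xs n)" using x dec1 by blast
    then show ?thesis by (auto simp: shift_beyond beyond_def x_def)
  qed
  then have sm: "strict_mono x" by (simp add: strict_mono_Suc_iff)
  have xX: "range x \<subseteq> X0" using x dec[of 0] by (auto simp: Xs_def)
  have inf: "range x \<in> infsets X"
    using xX X0(1) sm
    by (auto simp: infsets_def dest: range_inj_infinite strict_mono_imp_inj_on)
  have "D u (beyond u (range x))" if u: "finite u" "u \<subseteq> range x" for u
  proof (cases "u = {}")
    case True
    have "range x \<in> infsets X0" using xX inf by (auto simp: infsets_def)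
    then have "D {} (range x)" using mono X0 by blast
    then show ?thesis using True by (simp add: beyond_def)
  next
    case False
    then obtain n where n: "Max u = x n" using u Max_in by blast
    have "u \<subseteq> {..Inf (Xs n)} \<inter> X"
    proof
      fix a assume a: "a \<in> u"
      then have "a \<le> x n" using u n Max_ge by metis
      then show "a \<in> {..Inf (Xs n)} \<inter> X" using a u xX X0(1) by (auto simp: x_def infsets_def)
    qed
    \<comment> \<open>\<open>n\<close> is the index of the largest element of \<open>u\<close>, so
      all of \<open>u\<close> was visible when \<open>Xs (Suc n)\<close> was chosen.\<close>
    then have D: "D u (Xs (Suc n))" using stepn[of n] by (simp add: step_def)
    have "beyond u (range x) \<subseteq> Xs (Suc n)"
    proof
      fix a assume a: "a \<in> beyond u (range x)"
      then obtain k where k: "a = x k" by (auto simp: beyond_def)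
      have "x n < x k" using a k Max_in[OF u(1) False] unfolding n beyond_def by simp
      then have "Suc n \<le> k" using sm by (simp add: strict_mono_less Suc_le_eq)
      then show "a \<in> Xs (Suc n)" using x[of k] dec k by blast
    qed
    then have "beyond u (range x) \<in> infsets (Xs (Suc n))"
      using beyond_infinite[OF u(1)] inf by (auto simp: infsets_def)
    then show ?thesis using D mono by blast
  qed
  then show thesis using that inf by blast
qed

text \<open>Acceptance and rejection: \<open>Y\<close> accepts a stem if all continuations of it
  from \<open>Y\<close> have the colour. A first fusion decides every stem. If the empty stem is
  accepted, \<open>Y\<close> is homogeneous. Otherwise a second fusion makes rejection pass to
  one-point extensions, so every finite stem in \<open>Z\<close> is rejected; but a coloured
  \<open>A\<close> would, by continuity, have an accepted initial segment.\<close>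

lemma clopen_Ramsey:
  assumes c: "locally_constant X c" and X: "infinite X"
  obtains Y where "Y \<in> infsets X" "(\<forall>A\<in>infsets Y. c A) \<or> (\<forall>A\<in>infsets Y. \<not> c A)"
proof -
  define acc where "acc u Y \<longleftrightarrow> (\<forall>A\<in>infsets (beyond u Y). c (u \<union> A))" for u Y
  have acc_mono: "acc u Y \<Longrightarrow> Z \<subseteq> Y \<Longrightarrow> acc u Z" for u Y Z
    unfolding acc_def using infsets_mono[OF _ beyond_mono] by meson
  have beyond2: "beyond u (beyond u Y) = beyond u Y" for u Y by (auto simp: beyond_def)
  define D where "D u Y \<longleftrightarrow> acc u Y \<or> (\<forall>Z\<in>infsets Y. \<not> acc u Z)" for u Y
  obtain Y where Y: "Y \<in> infsets X" "\<And>u. finite u \<Longrightarrow> u \<subseteq> Y \<Longrightarrow> D u (beyond u Y)"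
  proof (rule fusion[of D X])
    show "\<And>u Y Z. D u Y \<Longrightarrow> Z \<in> infsets Y \<Longrightarrow> D u Z"
      using acc_mono infsets_trans unfolding D_def by (simp add: infsets_def) (meson order_trans)
    show "\<exists>Z\<in>infsets Y. D u Z" if "Y \<in> infsets X" for u Y
    proof (cases "\<exists>Z\<in>infsets Y. acc u Z")
      case True then show ?thesis by (auto simp: D_def)
    next
      case False
      moreover have "Y \<in> infsets Y" using that by (auto simp: infsets_def)
      ultimately show ?thesis by (auto simp: D_def)
    qed
  qed (use X in auto)
  show thesis
  proof (cases "acc {} Y")
    case True
    then have "\<forall>A\<in>infsets Y. c A" by (simp add: acc_def beyond_def)
    then show thesis using that Y by blast
  next
    case rej: False
    define E where "E u Z \<longleftrightarrow> acc u Y \<or> (\<forall>n\<in>beyond u Z. \<not> acc (insert n u) Y)" for u Z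
    obtain Z where Z: "Z \<in> infsets Y" "\<And>u. finite u \<Longrightarrow> u \<subseteq> Z \<Longrightarrow> E u (beyond u Z)"
    proof (rule fusion[of E Y])
      show "\<And>u Y Z. E u Y \<Longrightarrow> Z \<in> infsets Y \<Longrightarrow> E u Z"
        unfolding E_def beyond_def infsets_def by blast
      show "infinite Y" using Y by (auto simp: infsets_def)
      show "\<exists>W\<in>infsets Z. E u W" if u: "finite u" "u \<subseteq> Y" and Z: "Z \<in> infsets Y" for u Z
      proof (rule ccontr)
        assume neg: "\<not> ?thesis"
        then have na: "\<not> acc u Y" using Z unfolding E_def infsets_def by blast
        \<comment> \<open>If no \<open>W\<close> works, infinitely many one-point extensions of
          \<open>u\<close> are accepted. They form a set \<open>N\<close> that accepts
          \<open>u\<close>: a continuation inside \<open>N\<close> begins with some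
          \<open>n\<close>, and its rest continues the accepted stem \<open>insert n u\<close>. The
          decision \<open>D\<close> then makes \<open>u\<close> accepted, against
          \<open>na\<close>.\<close>
        define N where "N = {n \<in> beyond u Z. acc (insert n u) Y}"
        have inf: "infinite N"
        proof
          assume "finite N"
          then have "Z - N \<in> infsets Z" using Z by (auto simp: infsets_def)
          moreover have "E u (Z - N)" by (auto simp: E_def N_def beyond_def)
          ultimately show False using neg by blast
        qed
        have "acc u N" unfolding acc_def
        proof
          fix A assume A: "A \<in> infsets (beyond u N)"
          define n where "n = Inf A"
          have n: "n \<in> A" "n \<in> N"
            using Inf_in_infsets[OF A] A by (auto simp: n_def infsets_def beyond_def)
          have "shift A \<subseteq> beyond (insert n u) Y"
            using A Z unfolding shift_beyond n_def[symmetric] N_def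
            by (auto simp: infsets_def beyond_def)
          then have "shift A \<in> infsets (beyond (insert n u) Y)"
            using shift_infsets[OF A] by (auto simp: infsets_def)
          then have "c (insert n u \<union> shift A)" using n by (auto simp: N_def acc_def)
          moreover have "insert n u \<union> shift A = u \<union> A" using n by (auto simp: shift_def n_def)
          ultimately show "c (u \<union> A)" by simp
        qed
        moreover have "N \<in> infsets (beyond u Y)"
          using inf Z by (auto simp: N_def infsets_def beyond_def)
        ultimately have "acc u (beyond u Y)" using Y(2)[OF u] by (auto simp: D_def)
        then show False using na by (simp add: acc_def beyond2)
      qed
    qed auto
    \<comment> \<open>Induction adding a new maximum \<open>n\<close>: by \<open>E\<close>,
      rejection of \<open>u\<close> passes to \<open>insert n u\<close>.\<close>
    have all_rej: "\<not> acc u Y" if "finite u" "u \<subseteq> Z" for u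
      using that
    proof (induction u rule: finite_linorder_max_induct)
      case empty
      show ?case by (rule rej)
    next
      case (insert n u)
      then have "E u (beyond u Z)" "\<not> acc u Y" using Z by auto
      moreover have "n \<in> beyond u (beyond u Z)" using insert by (auto simp: beyond_def)
      ultimately show ?case by (auto simp: E_def)
    qed
    have "\<not> c A" if A: "A \<in> infsets Z" for A
    proof
      assume cA: "c A"
      have AX: "A \<in> infsets X" using infsets_trans[OF A infsets_trans[OF Z(1) Y(1)]] .
      obtain k where k: "\<And>A'. A' \<in> infsets X \<Longrightarrow> A' \<inter> {..k} = A \<inter> {..k} \<Longrightarrow> c A' = c A"
        using locally_constantE[OF c AX] by blast
      let ?u = "A \<inter> {..k}"
      have u: "finite ?u" "?u \<subseteq> Z" using A by (auto simp: infsets_def)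
      \<comment> \<open>Discarding \<open>{..k}\<close> from the reservoir keeps
        \<open>?u \<union> W\<close> equal to \<open>A\<close> up to \<open>k\<close>, so it
        inherits the colour of \<open>A\<close>.\<close>
      have "c (?u \<union> W)" if W: "W \<in> infsets (beyond ?u (Y - {..k}))" for W
      proof -
        have "(?u \<union> W) \<inter> {..k} = ?u" using W by (auto simp: infsets_def beyond_def)
        moreover have "?u \<union> W \<in> infsets X" using W Y AX by (auto simp: infsets_def beyond_def)
        ultimately show ?thesis using k[of "?u \<union> W"] cA by simp
      qed
      then have "acc ?u (Y - {..k})" by (simp add: acc_def)
      then have "acc ?u (beyond ?u (Y - {..k}))" by (simp add: acc_def beyond2)
      moreover have "beyond ?u (Y - {..k}) \<in> infsets (beyond ?u Y)"
        using beyond_infinite[OF u(1), of "Y - {..k}"] beyond_mono[of "Y - {..k}" Y] Y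
        by (auto simp: infsets_def)
      moreover have "D ?u (beyond ?u Y)" using Y(2) u Z by (auto simp: infsets_def)
      ultimately have "acc ?u (beyond ?u Y)" by (auto simp: D_def)
      then have "acc ?u Y" by (simp add: acc_def beyond2)
      then show False using all_rej u by blast
    qed
    then show thesis using that[OF infsets_trans[OF Z(1) Y(1)]] by simp
  qed
qed

lemma clopen_Ramsey_family:
  assumes "finite I" "\<And>i. i \<in> I \<Longrightarrow> locally_constant X (c i)" "infinite X"
  obtains Y where "Y \<in> infsets X"
    "\<And>i. i \<in> I \<Longrightarrow> (\<forall>A\<in>infsets Y. c i A) \<or> (\<forall>A\<in>infsets Y. \<not> c i A)"
proof -
  have "\<exists>Y\<in>infsets X. \<forall>i\<in>I. (\<forall>A\<in>infsets Y. c i A) \<or> (\<forall>A\<in>infsets Y. \<not> c i A)"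
    using assms
  proof (induction I rule: finite_induct)
    case empty
    then show ?case by (auto simp: infsets_def)
  next
    case (insert i I)
    then obtain Y where Y: "Y \<in> infsets X"
      "\<forall>i\<in>I. (\<forall>A\<in>infsets Y. c i A) \<or> (\<forall>A\<in>infsets Y. \<not> c i A)" by auto
    have "locally_constant Y (c i)" "infinite Y"
      using Y(1) locally_constant_subset[OF insert.prems(1)] by (auto simp: infsets_def)
    then obtain Z where Z: "Z \<in> infsets Y"
      "(\<forall>A\<in>infsets Z. c i A) \<or> (\<forall>A\<in>infsets Z. \<not> c i A)"
      using clopen_Ramsey by blast
    moreover have "A \<in> infsets Y" if "A \<in> infsets Z" for A
      using infsets_trans[OF that Z(1)] .
    ultimately show ?case
      using Y(2) infsets_trans[OF Z(1) Y(1)] by (intro bexI[of _ Z]) (metis insert_iff)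
  qed
  then show thesis using that by blast
qed

section \<open>Determined initial segments\<close>

definition determined :: "(nat set \<Rightarrow> 'c) \<Rightarrow> nat set \<Rightarrow> nat set \<Rightarrow> bool" where
  "determined F X u \<longleftrightarrow>
     (\<forall>A\<in>infsets (beyond u X). \<forall>A'\<in>infsets (beyond u X). F (u \<union> A) = F (u \<union> A'))"

text \<open>The last element of the shortest initial segment of \<open>A\<close> that determines the value of \<open>F\<close>.\<close>

definition depth :: "(nat set \<Rightarrow> 'c) \<Rightarrow> nat set \<Rightarrow> nat set \<Rightarrow> nat" where
  "depth F X A = (LEAST n. n \<in> A \<and> determined F X (A \<inter> {..n}))"

lemma determined_Un:
  assumes "determined F X u" "w \<subseteq> beyond u X"
  shows "determined F X (u \<union> w)"
  unfolding determined_def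
proof (intro ballI)
  fix A A' assume "A \<in> infsets (beyond (u \<union> w) X)" "A' \<in> infsets (beyond (u \<union> w) X)"
  then have "w \<union> A \<in> infsets (beyond u X)" "w \<union> A' \<in> infsets (beyond u X)"
    using assms(2) by (auto simp: infsets_def beyond_def)
  then have "F (u \<union> (w \<union> A)) = F (u \<union> (w \<union> A'))"
    using assms(1) unfolding determined_def by blast
  then show "F (u \<union> w \<union> A) = F (u \<union> w \<union> A')" by (simp add: Un_assoc)
qed

lemma determined_init:
  assumes "determined F X u" "u \<subseteq> v" "v \<subseteq> X" "\<And>x y. x \<in> v - u \<Longrightarrow> y \<in> u \<Longrightarrow> y < x"
  shows "determined F X v"
proof -
  have "v - u \<subseteq> beyond u X" using assms(3,4) by (auto simp: beyond_def)
  from determined_Un[OF assms(1) this] show ?thesis using assms(2) by (simp add: Un_absorb1)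
qed

lemma determined_cut_eq:
  assumes "determined F X (A \<inter> {..n})" "A \<in> infsets X" "A' \<in> infsets X"
    "A' \<inter> {..n} = A \<inter> {..n}"
  shows "F A' = F A"
proof -
  have tail: "B \<inter> {n<..} \<in> infsets (beyond (A \<inter> {..n}) X)" if "B \<in> infsets X" for B
  proof -
    have "infinite (B - {..n})" using that by (simp add: infsets_def)
    moreover have "B - {..n} = B \<inter> {n<..}" by auto
    ultimately show ?thesis using that by (auto simp: infsets_def beyond_def)
  qed
  have split: "B = B \<inter> {..n} \<union> B \<inter> {n<..}" for B by auto
  have "F (A \<inter> {..n} \<union> A' \<inter> {n<..}) = F (A \<inter> {..n} \<union> A \<inter> {n<..})"
    using assms(1) tail[OF assms(2)] tail[OF assms(3)] unfolding determined_def by blast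
  then show ?thesis using split[of A] split[of A'] assms(4) by simp
qed

lemma determined_exists:
  assumes "locally_constant X F" "A \<in> infsets X"
  obtains n where "n \<in> A" "determined F X (A \<inter> {..n})"
proof -
  obtain k where k: "\<And>A'. A' \<in> infsets X \<Longrightarrow> A' \<inter> {..k} = A \<inter> {..k} \<Longrightarrow> F A' = F A"
    using locally_constantE[OF assms] by blast
  \<comment> \<open>Since \<open>n\<close> lies in \<open>A\<close>, points beyond the stem
    \<open>A \<inter> {..n}\<close> exceed \<open>n\<close> and hence the modulus
    \<open>k\<close>.\<close>
  obtain n where n: "n \<in> A" "n \<ge> k"
    using assms(2) unfolding infsets_def infinite_nat_iff_unbounded_le by blast
  have "F (A \<inter> {..n} \<union> W) = F A" if W: "W \<in> infsets (beyond (A \<inter> {..n}) X)" for W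
  proof (rule k)
    show "A \<inter> {..n} \<union> W \<in> infsets X"
      using W assms(2) by (auto simp: infsets_def beyond_def)
    have "\<forall>x\<in>W. n < x" using W n(1) by (auto simp: infsets_def beyond_def)
    then show "(A \<inter> {..n} \<union> W) \<inter> {..k} = A \<inter> {..k}" using n(2) by fastforce
  qed
  then have "determined F X (A \<inter> {..n})" unfolding determined_def by simp
  then show thesis using that n by blast
qed

lemma depth:
  assumes "locally_constant X F" "A \<in> infsets X"
  shows "depth F X A \<in> A" "determined F X (A \<inter> {..depth F X A})"
proof -
  have "\<exists>n. n \<in> A \<and> determined F X (A \<inter> {..n})" using determined_exists[OF assms] by metis
  from LeastI_ex[OF this]
  show "depth F X A \<in> A" "determined F X (A \<inter> {..depth F X A})"
    by (auto simp: depth_def)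
qed

text \<open>\<open>depth\<close> searches only stems ending at a point of \<open>A\<close>. Below
  the depth there is either such a stem, excluded by minimality, or the empty stem, excluded by
  assumption.\<close>

lemma depth_minimal:
  assumes "locally_constant X F" "A \<in> infsets X" "\<not> determined F X {}"
  shows "\<not> determined F X (A \<inter> {..<depth F X A})"
proof (cases "A \<inter> {..<depth F X A} = {}")
  case True
  then show ?thesis using assms(3) by simp
next
  case False
  define n where "n = Max (A \<inter> {..<depth F X A})"
  have n: "n \<in> A \<inter> {..<depth F X A}" unfolding n_def using False by (intro Max_in) auto
  have "A \<inter> {..<depth F X A} = A \<inter> {..n}"
    using n Max_ge[of "A \<inter> {..<depth F X A}"] by (auto simp: n_def)
  moreover have "\<not> (n \<in> A \<and> determined F X (A \<inter> {..n}))"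
    using n not_less_Least[of n "\<lambda>n. n \<in> A \<and> determined F X (A \<inter> {..n})"]
    unfolding depth_def by simp
  ultimately show ?thesis using n by simp
qed

lemma depth_eqI:
  assumes "n \<in> A" "determined F X (A \<inter> {..n})" "\<not> determined F X (A \<inter> {..<n})" "A \<subseteq> X"
  shows "depth F X A = n"
  unfolding depth_def
proof (rule Least_equality)
  show "n \<in> A \<and> determined F X (A \<inter> {..n})" using assms(1,2) by simp
  fix k assume k: "k \<in> A \<and> determined F X (A \<inter> {..k})"
  show "n \<le> k"
  proof (rule ccontr)
    assume "\<not> n \<le> k"
    then have "determined F X (A \<inter> {..<n})"
      using assms(4) by (rule_tac determined_init[OF conjunct2[OF k]]) auto
    then show False using assms(3) by blast
  qed
qed

text \<open>The stem cut off at the depth already fixes the depth, so \<open>depth\<close> is its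
  own modulus of continuity.\<close>

lemma depth_cut:
  assumes "locally_constant X F" "\<not> determined F X {}" "A \<in> infsets X" "A' \<in> infsets X"
    "A' \<inter> {..depth F X A} = A \<inter> {..depth F X A}"
  shows "depth F X A' = depth F X A"
proof (rule depth_eqI)
  let ?d = "depth F X A"
  have "?d \<in> A \<inter> {..?d}" using depth[OF assms(1,3)] by simp
  then show "?d \<in> A'" unfolding assms(5)[symmetric] by simp
  show "determined F X (A' \<inter> {..?d})" using depth[OF assms(1,3)] assms(5) by simp
  have "B \<inter> {..<?d} = B \<inter> {..?d} \<inter> {..<?d}" for B by auto
  then have "A' \<inter> {..<?d} = A \<inter> {..<?d}" using assms(5) by metis
  then show "\<not> determined F X (A' \<inter> {..<?d})" using depth_minimal[OF assms(1,3,2)] by simp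
  show "A' \<subseteq> X" using assms(4) by (simp add: infsets_def)
qed

lemma locally_constant_depth:
  assumes "locally_constant X F" "\<not> determined F X {}"
  shows "locally_constant X (depth F X)"
  unfolding locally_constant_def by (intro ballI exI impI) (rule depth_cut[OF assms])

text \<open>One modulus fixes the removed point, a second one the value of \<open>F\<close> after
  its removal; agreement up to the larger one gives both.\<close>

lemma locally_constant_remove:
  assumes m: "locally_constant X m" and F: "locally_constant X F"
  shows "locally_constant X (\<lambda>A. F (A - {m A}))"
  unfolding locally_constant_def
proof
  fix A assume A: "A \<in> infsets X"
  have rm: "B - {n} \<in> infsets X" if "B \<in> infsets X" for B n
    using that by (auto simp: infsets_def)
  obtain k where k: "\<And>A'. A' \<in> infsets X \<Longrightarrow> A' \<inter> {..k} = A \<inter> {..k} \<Longrightarrow> m A' = m A"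
    using locally_constantE[OF m A] by blast
  obtain l where l: "l \<ge> k" "\<And>A'. A' \<in> infsets X \<Longrightarrow>
      A' \<inter> {..l} = (A - {m A}) \<inter> {..l} \<Longrightarrow> F A' = F (A - {m A})"
    using locally_constantE[OF F rm[OF A]] by blast
  have "F (A' - {m A'}) = F (A - {m A})"
    if A': "A' \<in> infsets X" "A' \<inter> {..l} = A \<inter> {..l}" for A'
  proof -
    have "B \<inter> {..k} = B \<inter> {..l} \<inter> {..k}" for B using l(1) by auto
    then have "A' \<inter> {..k} = A \<inter> {..k}" using A'(2) by metis
    then have eq: "m A' = m A" using k[OF A'(1)] by simp
    have "(A' - {m A}) \<inter> {..l} = (A - {m A}) \<inter> {..l}" using A'(2) by (metis Int_Diff Int_commute)
    then show ?thesis using l(2)[OF rm[OF A'(1)]] by (simp add: eq)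
  qed
  then show "\<exists>k. \<forall>A'\<in>infsets X. A' \<inter> {..k} = A \<inter> {..k} \<longrightarrow>
      F (A' - {m A'}) = F (A - {m A})" by blast
qed

text \<open>Shrinking the reservoir may turn an undetermined stem into a determined one. Fusion
  decides for each stem whether this can happen, and if so lets it happen at once.\<close>

lemma stably_determined:
  assumes "infinite U"
  obtains X where "X \<in> infsets U"
    "\<And>u Y. finite u \<Longrightarrow> u \<subseteq> X \<Longrightarrow> Y \<in> infsets X \<Longrightarrow> determined F Y u \<Longrightarrow> determined F X u"
proof -
  have mono: "determined F Z u" if "determined F Y u" "Z \<subseteq> Y" for u Y Z
    using that(1) unfolding determined_def by (simp add: infsets_mono[OF _ beyond_mono[OF that(2)]])
  define D where "D u Y \<longleftrightarrow> determined F Y u \<or> (\<forall>Z\<in>infsets Y. \<not> determined F Z u)" for u Y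
  \<comment> \<open>Fusion speaks about the reservoir \<open>beyond u X\<close>; determination of
    \<open>u\<close> sees nothing else.\<close>
  have idem: "determined F (beyond u Y) u = determined F Y u" for u Y
    unfolding determined_def by (simp add: beyond_def)
  obtain X where X: "X \<in> infsets U" "\<And>u. finite u \<Longrightarrow> u \<subseteq> X \<Longrightarrow> D u (beyond u X)"
  proof (rule fusion[of D U])
    show "D u Z" if D: "D u Y" and Z: "Z \<in> infsets Y" for u Y Z
    proof -
      have "Z \<subseteq> Y" using Z by (simp add: infsets_def)
      then show ?thesis using D mono[of Y u Z] infsets_mono[of _ Z Y] unfolding D_def by auto
    qed
    show "\<exists>Z\<in>infsets Y. D u Z" if "Y \<in> infsets U" for u Y
    proof (cases "\<exists>Z\<in>infsets Y. determined F Z u")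
      case True then show ?thesis by (auto simp: D_def)
    next
      case False
      moreover have "Y \<in> infsets Y" using that by (auto simp: infsets_def)
      ultimately show ?thesis by (auto simp: D_def)
    qed
  qed (use assms in auto)
  show thesis
  proof (rule that[OF X(1)])
    fix u Y assume u: "finite u" "u \<subseteq> X" and Y: "Y \<in> infsets X" "determined F Y u"
    have "beyond u Y \<in> infsets (beyond u X)"
      using Y beyond_infinite[OF u(1)] beyond_mono[of Y X] by (auto simp: infsets_def)
    moreover have "determined F (beyond u Y) u" using Y idem by blast
    ultimately have "determined F (beyond u X) u" using X(2)[OF u] unfolding D_def by blast
    then show "determined F X u" using idem by blast
  qed
qed

text \<open>Otherwise undetermined stems could be prolonged forever by larger points. By continuity
  their infinite union has a determined initial segment, which is contained in some stage
  \<open>w k\<close> and makes that stage determined.\<close>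

lemma last_undetermined:
  assumes F: "locally_constant X F" and Y: "Y \<in> infsets X" and e: "\<not> determined F X {}"
  obtains v where "finite v" "v \<subseteq> Y" "\<not> determined F X v"
    "\<And>n. n \<in> beyond v Y \<Longrightarrow> determined F X (insert n v)"
proof -
  have "\<exists>v. finite v \<and> v \<subseteq> Y \<and> \<not> determined F X v \<and>
    (\<forall>n\<in>beyond v Y. determined F X (insert n v))"
  proof (rule ccontr)
    assume "\<not> ?thesis"
    then have ex: "\<exists>n. n \<in> beyond v Y \<and> \<not> determined F X (insert n v)"
      if "finite v" "v \<subseteq> Y" "\<not> determined F X v" for v
      using that by blast
    define p where "p v = (SOME n. n \<in> beyond v Y \<and> \<not> determined F X (insert n v))" for v
    define w where "w = rec_nat {} (\<lambda>_ v. insert (p v) v)"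
    have w0: "w 0 = {}" and wS: "w (Suc n) = insert (p (w n)) (w n)" for n
      by (simp_all add: w_def)
    have p: "p v \<in> beyond v Y \<and> \<not> determined F X (insert (p v) v)"
      if "finite v" "v \<subseteq> Y" "\<not> determined F X v" for v
      unfolding p_def by (rule someI_ex) (rule ex[OF that])
    have w: "finite (w n) \<and> w n \<subseteq> Y \<and> \<not> determined F X (w n)" for n
    proof (induction n)
      case 0
      then show ?case using e by (simp add: w0)
    next
      case (Suc n)
      then show ?case using p[of "w n"] beyond_subset[of "w n" Y] by (auto simp: wS)
    qed
    have pw: "p (w n) \<in> beyond (w n) Y" for n using p[of "w n"] w[of n] by blast
    have mono: "w m \<subseteq> w n" if "m \<le> n" for m n
      using that by (rule lift_Suc_mono_le[rotated]) (auto simp: wS)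
    have less: "y < x" if "x \<in> w n - w m" "y \<in> w m" for x y m n
      using that
    proof (induction n)
      case 0
      then show ?case by (simp add: w0)
    next
      case (Suc n)
      show ?case
      proof (cases "x \<in> w n")
        case True
        then show ?thesis using Suc by blast
      next
        case False
        then have x: "x = p (w n)" using Suc.prems by (simp add: wS)
        have "m \<le> n" using Suc.prems mono[of "Suc n" m] by (metis DiffE not_less_eq_eq subsetD)
        then have "y \<in> w n" using Suc.prems mono by blast
        then show ?thesis using pw[of n] x by (simp add: beyond_def)
      qed
    qed
    let ?A = "\<Union>n. w n"
    have card: "card (w n) = n" for n
    proof (induction n)
      case 0
      then show ?case by (simp add: w0)
    next
      case (Suc n)
      have "p (w n) \<notin> w n" using pw[of n] by (auto simp: beyond_def)
      then show ?case using w[of n] Suc by (simp add: wS)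
    qed
    have "infinite ?A"
    proof
      assume fin: "finite ?A"
      have "card (w (Suc (card ?A))) \<le> card ?A" by (rule card_mono[OF fin]) auto
      then show False by (simp add: card)
    qed
    then have A: "?A \<in> infsets X" using w Y by (auto simp: infsets_def)
    obtain n where n: "n \<in> ?A" "determined F X (?A \<inter> {..n})"
      using determined_exists[OF F A] by blast
    then obtain k where k: "n \<in> w k" by blast
    have "?A \<inter> {..n} \<subseteq> w k"
    proof
      fix x assume x: "x \<in> ?A \<inter> {..n}"
      then obtain l where l: "x \<in> w l" by blast
      show "x \<in> w k" using less[of x l k n] l k x by force
    qed
    moreover have "w k \<subseteq> X" using w Y by (auto simp: infsets_def)
    ultimately have "determined F X (w k)"
      using n(2) by (rule_tac determined_init) auto
    then show False using w by blast
  qed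
  then show thesis using that by blast
qed

section \<open>Bad continuous maps\<close>

definition descending :: "'p set \<Rightarrow> ('p \<Rightarrow> 'p \<Rightarrow> bool) \<Rightarrow> (nat \<Rightarrow> 'p) \<Rightarrow> bool" where
  "descending P le a \<longleftrightarrow> (\<forall>n. a n \<in> P \<and> strict le (a (Suc n)) (a n))"

lemma poset_onD:
  assumes "poset_on P le"
  shows "x \<in> P \<Longrightarrow> le x x"
    and "\<lbrakk>x \<in> P; y \<in> P; le x y; le y x\<rbrakk> \<Longrightarrow> x = y"
    and "\<lbrakk>x \<in> P; y \<in> P; z \<in> P; le x y; le y z\<rbrakk> \<Longrightarrow> le x z"
  using assms unfolding poset_on_def by blast+

lemma strict_trans:
  assumes "poset_on P le" "x \<in> P" "y \<in> P" "z \<in> P" "strict le x y" "strict le y z"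
  shows "strict le x z"
  using poset_onD(2)[OF assms(1), of x y] poset_onD(2)[OF assms(1), of y z]
    poset_onD(3)[OF assms(1), of x y z] assms(2-) unfolding strict_def by auto

lemma strict_le_trans:
  assumes "poset_on P le" "x \<in> P" "y \<in> P" "z \<in> P" "strict le x y" "le y z"
  shows "strict le x z"
  using poset_onD(2)[OF assms(1), of x y] poset_onD(2)[OF assms(1), of y z]
    poset_onD(3)[OF assms(1), of x y z] assms(2-) unfolding strict_def by auto

lemma le_strict_trans:
  assumes "poset_on P le" "x \<in> P" "y \<in> P" "z \<in> P" "le x y" "strict le y z"
  shows "strict le x z"
  using poset_onD(2)[OF assms(1), of x y] poset_onD(2)[OF assms(1), of y z]
    poset_onD(3)[OF assms(1), of x y z] assms(2-) unfolding strict_def by auto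

lemma descending_less:
  assumes "poset_on P le" "descending P le a" "i < j"
  shows "strict le (a j) (a i)"
  using assms(3)
proof (induction j)
  case (Suc j)
  have a: "a n \<in> P" "strict le (a (Suc n)) (a n)" for n
    using assms(2) by (auto simp: descending_def)
  show ?case
  proof (cases "i = j")
    case False
    then have "strict le (a j) (a i)" using Suc by simp
    then show ?thesis using strict_trans[OF assms(1) a(1) a(1) a(1) a(2)] by blast
  qed (simp add: a)
qed simp

text \<open>Ramsey makes the comparison of depths uniform. If depth never increased, it would stay
  bounded along the iterated shifts \<open>S n\<close>; but the depth of \<open>S n\<close> belongs
  to \<open>S n\<close>, whose elements are at least \<open>n\<close>.\<close>

lemma depth_shift_increasing:
  assumes F: "locally_constant X F" and e: "\<not> determined F X {}" and Y: "Y \<in> infsets X"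
  obtains Z where "Z \<in> infsets Y" "\<And>A. A \<in> infsets Z \<Longrightarrow> depth F X A < depth F X (shift A)"
proof -
  have YX: "Y \<subseteq> X" "infinite Y" using Y by (auto simp: infsets_def)
  have m: "locally_constant X (depth F X)" by (rule locally_constant_depth[OF F e])
  have "locally_constant Y (\<lambda>A. depth F X A < depth F X (shift A))"
    by (rule locally_constant_subset[OF locally_constant_pair[OF m locally_constant_shift[OF m]] YX(1)])
  then obtain Z where Z: "Z \<in> infsets Y"
    "(\<forall>A\<in>infsets Z. depth F X A < depth F X (shift A)) \<or>
     (\<forall>A\<in>infsets Z. \<not> depth F X A < depth F X (shift A))"
    using clopen_Ramsey YX(2) by blast
  moreover have False if bad: "\<forall>A\<in>infsets Z. \<not> depth F X A < depth F X (shift A)"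
  proof -
    define S where "S n = (shift ^^ n) Z" for n
    have SS: "S (Suc n) = shift (S n)" for n by (simp add: S_def)
    have S: "S n \<in> infsets Z" for n
    proof (induction n)
      case 0
      then show ?case using Z by (auto simp: S_def infsets_def)
    qed (simp add: SS shift_infsets)
    have ge: "x \<ge> n" if "x \<in> S n" for x n
      using that
    proof (induction n arbitrary: x)
      case (Suc n)
      have "n \<le> Inf (S n)" using Suc.IH Inf_in_infsets[OF S] by blast
      moreover have "Inf (S n) < x" using Suc.prems by (auto simp: SS shift_beyond beyond_def)
      ultimately show ?case by simp
    qed simp
    have dec: "depth F X (S n) \<le> depth F X (S 0)" for n
    proof (induction n)
      case (Suc n)
      have "depth F X (S (Suc n)) \<le> depth F X (S n)" using bad S[of n] SS by (simp add: not_less)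
      then show ?case using Suc by simp
    qed simp
    let ?n = "Suc (depth F X (S 0))"
    have "S ?n \<in> infsets X" using infsets_trans[OF infsets_trans[OF S Z(1)] Y] .
    then have "depth F X (S ?n) \<in> S ?n" by (rule depth[OF F])
    then show False using ge dec[of ?n] by fastforce
  qed
  ultimately show thesis using that by blast
qed

text \<open>Homogeneity reduces the claim to sets starting with an undetermined \<open>v\<close> all of whose
  one-point extensions are determined: there the values of \<open>F\<close> form a sequence.\<close>

lemma depth_removal_increasing:
  assumes ac: "\<forall>A. antichain_in P le A \<longrightarrow> finite A"
    and nd: "\<nexists>a. descending P le a"
    and F: "locally_constant X F" "\<And>A. A \<in> infsets X \<Longrightarrow> F A \<in> P"
    and stable: "\<And>u Y. finite u \<Longrightarrow> u \<subseteq> X \<Longrightarrow> Y \<in> infsets X \<Longrightarrow> determined F Y u \<Longrightarrow> determined F X u"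
    and e: "\<not> determined F X {}" and Y: "Y \<in> infsets X"
  obtains Z where "Z \<in> infsets Y" "\<And>A. A \<in> infsets Z \<Longrightarrow> strict le (F A) (F (A - {depth F X A}))"
proof -
  \<comment> \<open>Each of these relations will hold everywhere or nowhere. If none holds, the
    values are pairwise incomparable, so it suffices to exclude equality, descent and
    incomparability.\<close>
  let ?R = "{strict le, (=), \<lambda>x y. strict le y x}"
  let ?c = "\<lambda>R A. R (F A) (F (A - {depth F X A}))"
  have YX: "Y \<subseteq> X" "infinite Y" using Y by (auto simp: infsets_def)
  have lc: "locally_constant Y (?c R)" for R
    by (rule locally_constant_subset[OF locally_constant_pair[OF F(1)
          locally_constant_remove[OF locally_constant_depth[OF F(1) e] F(1)]] YX(1)])
  obtain Z where Z: "Z \<in> infsets Y"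
    and hom: "\<And>R. R \<in> ?R \<Longrightarrow> (\<forall>A\<in>infsets Z. ?c R A) \<or> (\<forall>A\<in>infsets Z. \<not> ?c R A)"
    by (rule clopen_Ramsey_family[of ?R Y ?c]) (use lc YX(2) in auto)
  have ZX: "Z \<in> infsets X" using infsets_trans[OF Z Y] .
  obtain v where v: "finite v" "v \<subseteq> Z" "\<not> determined F X v"
    "\<And>n. n \<in> beyond v Z \<Longrightarrow> determined F X (insert n v)"
    using last_undetermined[OF F(1) ZX e] by blast
  define V where "V = beyond v Z"
  have V: "V \<in> infsets Z" using beyond_infsets[OF v(1), of Z Z] ZX by (auto simp: V_def infsets_def)
  have Vinf: "infinite V" using V by (simp add: infsets_def)
  have vless: "y < x" if "x \<in> V" "y \<in> v" for x y using that by (auto simp: V_def beyond_def)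
  have vA: "v \<union> A \<in> infsets Z" if "A \<in> infsets V" for A
    using that v(2) V by (auto simp: infsets_def)
  have cut: "(v \<union> A) \<inter> {..Inf A} = insert (Inf A) v" "(v \<union> A) \<inter> {..<Inf A} = v"
    if A: "A \<in> infsets V" for A
  proof -
    have "Inf A \<in> A" "Inf A \<in> V" using Inf_in_infsets[OF A] A by (auto simp: infsets_def)
    then show "(v \<union> A) \<inter> {..Inf A} = insert (Inf A) v" "(v \<union> A) \<inter> {..<Inf A} = v"
      using Inf_nat_le[of _ A] vless[of "Inf A"] by (force simp: not_less[symmetric])+
  qed
  \<comment> \<open>\<open>v\<close> is undetermined but any one further point determines it, so the
    first point after \<open>v\<close> is the depth.\<close>
  have dep: "depth F X (v \<union> A) = Inf A" if A: "A \<in> infsets V" for A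
  proof (rule depth_eqI)
    show "Inf A \<in> v \<union> A" using Inf_in_infsets[OF A] by simp
    have "Inf A \<in> beyond v Z" using Inf_in_infsets[OF A] A by (auto simp: infsets_def V_def)
    then show "determined F X ((v \<union> A) \<inter> {..Inf A})" using v(4) by (simp add: cut[OF A])
    show "\<not> determined F X ((v \<union> A) \<inter> {..<Inf A})" using v(3) by (simp add: cut[OF A])
    show "v \<union> A \<subseteq> X" using vA[OF A] ZX by (auto simp: infsets_def)
  qed
  \<comment> \<open>For \<open>n\<close> in \<open>V\<close> this is one continuation of
    \<open>v\<close> starting at \<open>n\<close>; \<open>FA\<close> shows that any other has the
    same value, because \<open>insert n v\<close> is determined.\<close>
  define g where "g n = F (v \<union> V \<inter> {n..})" for n
  have tail: "V \<inter> {n..} \<in> infsets V" for n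
  proof -
    have "V \<inter> {n..} = V - {..<n}" by auto
    then show ?thesis using Vinf by (simp add: infsets_def Diff_infinite_finite)
  qed
  have Inftail: "Inf (V \<inter> {n..}) = n" if "n \<in> V" for n
    using that by (intro cInf_eq_minimum) auto
  have gP: "g n \<in> P" for n
    unfolding g_def using F(2) infsets_trans[OF vA[OF tail] ZX] by blast
  have FA: "F (v \<union> A) = g (Inf A)" if A: "A \<in> infsets V" for A
  proof -
    let ?n = "Inf A"
    have n: "?n \<in> V" using Inf_in_infsets[OF A] A by (auto simp: infsets_def)
    have "determined F X ((v \<union> V \<inter> {?n..}) \<inter> {..?n})"
      using v(4)[of ?n] n cut(1)[OF tail, of ?n] unfolding Inftail[OF n] V_def[symmetric] by simp
    moreover have "(v \<union> A) \<inter> {..?n} = (v \<union> V \<inter> {?n..}) \<inter> {..?n}"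
      using cut(1)[OF A] cut(1)[OF tail, of ?n] unfolding Inftail[OF n] by simp
    ultimately show ?thesis
      unfolding g_def
      using determined_cut_eq infsets_trans[OF vA[OF tail] ZX] infsets_trans[OF vA[OF A] ZX] by blast
  qed
  have rel: "(\<forall>i\<in>V. \<forall>j\<in>V. i < j \<longrightarrow> R (g i) (g j)) \<and> (\<forall>A\<in>infsets Z. ?c R A)
      \<or> (\<forall>i\<in>V. \<forall>j\<in>V. i < j \<longrightarrow> \<not> R (g i) (g j)) \<and> (\<forall>A\<in>infsets Z. \<not> ?c R A)"
    if "R \<in> ?R" for R
  proof -
    have "\<exists>A\<in>infsets Z. F A = g i \<and> F (A - {depth F X A}) = g j"
      if ij: "i \<in> V" "j \<in> V" "i < j" for i j
    proof -
      \<comment> \<open>The depth of \<open>v \<union> ?A\<close> is \<open>i\<close>, and removing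
        it leaves a continuation starting at \<open>j\<close>. Thus each pair \<open>g i\<close>,
        \<open>g j\<close> with \<open>i < j\<close> occurs as a value before and after
        removal.\<close>
      let ?A = "insert i (V \<inter> {j..})"
      have A: "?A \<in> infsets V" using tail[of j] ij by (auto simp: infsets_def)
      have I: "Inf ?A = i" using ij by (intro cInf_eq_minimum) auto
      have "i \<notin> v" using vless ij by blast
      then have "v \<union> ?A - {i} = v \<union> V \<inter> {j..}" using ij by auto
      then have "F (v \<union> ?A - {depth F X (v \<union> ?A)}) = g j" using dep[OF A] I by (simp add: g_def)
      moreover have "F (v \<union> ?A) = g i" using FA[OF A] I by simp
      ultimately show ?thesis using vA[OF A] by blast
    qed
    then show ?thesis using hom[OF that] by metis
  qed
  define x where "x = enumerate V"
  have x: "x n \<in> V" "x n < x (Suc n)" for n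
    unfolding x_def using enumerate_in_set enumerate_step Vinf by blast+
  have notdesc: "\<not> (\<forall>i\<in>V. \<forall>j\<in>V. i < j \<longrightarrow> strict le (g j) (g i))"
  proof
    assume "\<forall>i\<in>V. \<forall>j\<in>V. i < j \<longrightarrow> strict le (g j) (g i)"
    then have "descending P le (\<lambda>n. g (x n))" using x gP by (simp add: descending_def)
    then show False using nd by blast
  qed
  \<comment> \<open>A constant sequence would make \<open>v\<close> determined in \<open>Z\<close>,
    hence by stability in \<open>X\<close>.\<close>
  have noteq: "\<not> (\<forall>i\<in>V. \<forall>j\<in>V. i < j \<longrightarrow> g i = g j)"
  proof
    assume *: "\<forall>i\<in>V. \<forall>j\<in>V. i < j \<longrightarrow> g i = g j"
    have "g i = g j" if "i \<in> V" "j \<in> V" for i j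
      using * that by (metis linorder_neqE_nat)
    moreover have "Inf A \<in> V" if "A \<in> infsets V" for A
      using Inf_in_infsets[OF that] that by (auto simp: infsets_def)
    ultimately have "determined F Z v"
      unfolding determined_def V_def[symmetric] by (metis FA)
    then show False using stable[OF v(1) _ ZX] v(2,3) ZX by (auto simp: infsets_def)
  qed
  have "\<not> (\<forall>i\<in>V. \<forall>j\<in>V. i < j \<longrightarrow> \<not> strict le (g i) (g j) \<and> g i \<noteq> g j \<and> \<not> strict le (g j) (g i))"
  proof
    assume *: "\<forall>i\<in>V. \<forall>j\<in>V. i < j \<longrightarrow> \<not> strict le (g i) (g j) \<and> g i \<noteq> g j \<and> \<not> strict le (g j) (g i)"
    have ne: "g i \<noteq> g j \<and> \<not> le (g i) (g j)" if "i \<in> V" "j \<in> V" "i \<noteq> j" for i j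
      using that(3)
    proof (rule linorder_neqE_nat)
      assume "i < j"
      then show ?thesis using * that(1,2) unfolding strict_def by metis
    next
      assume "j < i"
      then show ?thesis using * that(1,2) unfolding strict_def by metis
    qed
    then have "inj_on g V" by (meson inj_onI)
    then have "infinite (g ` V)" using Vinf finite_imageD by blast
    moreover have "antichain_in P le (g ` V)" using ne gP unfolding antichain_in_def by blast
    ultimately show False using ac by blast
  qed
  then have "\<forall>A\<in>infsets Z. strict le (F A) (F (A - {depth F X A}))"
    using rel[of "strict le"] rel[of "(=)"] rel[of "\<lambda>x y. strict le y x"] notdesc noteq by auto
  then show thesis using that Z by blast
qed

text \<open>The witness for \<open>m\<close> is \<open>depth F X\<close>, computed throughout in the
  stable set \<open>X\<close>; the later refinements \<open>Y\<close> and \<open>Z\<close> only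
  restrict its arguments.\<close>

lemma bad_continuous_map_removal:
  assumes po: "poset_on P le" and ac: "\<forall>A. antichain_in P le A \<longrightarrow> finite A"
    and nd: "\<nexists>a. descending P le a" and U: "infinite U"
    and F: "locally_constant U F" "\<And>A. A \<in> infsets U \<Longrightarrow> F A \<in> P"
    and bad: "\<And>A. A \<in> infsets U \<Longrightarrow> \<not> le (F A) (F (shift A))"
  obtains X m where "X \<in> infsets U" "\<And>A. A \<in> infsets X \<Longrightarrow> m A \<in> A"
    "\<And>A. A \<in> infsets X \<Longrightarrow> m A < m (shift A)"
    "\<And>A. A \<in> infsets X \<Longrightarrow> strict le (F A) (F (A - {m A}))"
    "\<And>A A'. A \<in> infsets X \<Longrightarrow> A' \<in> infsets X \<Longrightarrow> A' \<inter> {..m A} = A \<inter> {..m A} \<Longrightarrow> F A' = F A"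
proof -
  obtain X where X: "X \<in> infsets U"
    and stable: "\<And>u Y. finite u \<Longrightarrow> u \<subseteq> X \<Longrightarrow> Y \<in> infsets X \<Longrightarrow> determined F Y u \<Longrightarrow> determined F X u"
    using stably_determined[OF U] by metis
  have FX: "locally_constant X F" "\<And>A. A \<in> infsets X \<Longrightarrow> F A \<in> P"
    using locally_constant_subset[OF F(1)] F(2) infsets_trans[OF _ X] X by (auto simp: infsets_def)
  have XX: "X \<in> infsets X" using X by (auto simp: infsets_def)
  \<comment> \<open>A determined empty stem means that \<open>F\<close> is constant on
    \<open>infsets X\<close>, and reflexivity then contradicts badness.\<close>
  have e: "\<not> determined F X {}"
  proof
    assume "determined F X {}"
    moreover have "beyond {} X = X" by (simp add: beyond_def)
    ultimately have "F ({} \<union> X) = F ({} \<union> shift X)"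
      unfolding determined_def using XX shift_infsets[OF XX] by metis
    then show False using bad[OF X] poset_onD(1)[OF po F(2)[OF X]] by simp
  qed
  obtain Y where Y: "Y \<in> infsets X" "\<And>A. A \<in> infsets Y \<Longrightarrow> depth F X A < depth F X (shift A)"
    using depth_shift_increasing[OF FX(1) e XX] by blast
  obtain Z where Z: "Z \<in> infsets Y"
    "\<And>A. A \<in> infsets Z \<Longrightarrow> strict le (F A) (F (A - {depth F X A}))"
    by (rule depth_removal_increasing[of P le X F Y]) (use ac nd FX stable e Y(1) in auto)
  have sub: "A \<in> infsets X" "A \<in> infsets Y" if "A \<in> infsets Z" for A
    using that infsets_trans Z(1) Y(1) by blast+
  show thesis
  proof (rule that[of Z "depth F X"])
    show "Z \<in> infsets U" using infsets_trans[OF infsets_trans[OF Z(1) Y(1)] X] .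
    show "F A' = F A" if "A \<in> infsets Z" "A' \<in> infsets Z"
      "A' \<inter> {..depth F X A} = A \<inter> {..depth F X A}" for A A'
      by (rule determined_cut_eq[OF depth(2)[OF FX(1)]]) (use that sub in auto)
  qed (use depth(1)[OF FX(1)] sub Y(2) Z(2) in auto)
qed

section \<open>Barriers\<close>

text \<open>The choice is harmless: members of a barrier are incomparable under inclusion, so at
  most one is an initial segment of \<open>A\<close>.\<close>

definition bseg :: "nat set set \<Rightarrow> nat set \<Rightarrow> nat set" where
  "bseg B A = (SOME s. s \<in> B \<and> init_seg s A)"

lemma barrier_Union_infinite:
  assumes "barrier B"
  shows "infinite (\<Union>B)"
proof
  assume "finite (\<Union>B)"
  then have "finite (Pow (\<Union>B))" by simp
  moreover have "B \<subseteq> Pow (\<Union>B)" by auto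
  ultimately have "finite B" by (rule finite_subset[rotated])
  then show False using assms by (simp add: barrier_def)
qed

lemma barrier_nonempty:
  assumes "barrier B" "s \<in> B"
  shows "s \<noteq> {}"
proof
  assume e: "s = {}"
  have "infinite (B - {{}})" using assms(1) by (simp add: barrier_def)
  then obtain t where "t \<in> B" "t \<noteq> {}" 
    by (metis Diff_iff finite.emptyI insertCI ex_in_conv)
  then show False using assms e unfolding barrier_def by (metis psubsetI empty_subsetI)
qed

lemma init_seg_linear:
  assumes "init_seg s A" "init_seg t A"
  shows "s \<subseteq> t \<or> t \<subseteq> s"
proof (rule ccontr)
  assume "\<not> ?thesis"
  then obtain x y where xy: "x \<in> s" "x \<notin> t" "y \<in> t" "y \<notin> s" by blast
  then have "x \<in> A" "y \<in> A" using assms by (auto simp: init_seg_def)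
  then show False using assms xy linear[of x y] unfolding init_seg_def by blast
qed

lemma barrier_init_seg_eq:
  assumes "barrier B" "s \<in> B" "t \<in> B" "init_seg s A" "init_seg t A"
  shows "s = t"
proof -
  have "\<not> s \<subset> t" "\<not> t \<subset> s" using assms(1-3) by (auto simp: barrier_def)
  then show ?thesis using init_seg_linear[OF assms(4,5)] by blast
qed

lemma bseg:
  assumes "barrier B" "A \<in> infsets (\<Union>B)"
  shows "bseg B A \<in> B" "init_seg (bseg B A) A"
proof -
  have "\<exists>s. s \<in> B \<and> init_seg s A" using assms unfolding barrier_def infsets_def by blast
  from someI_ex[OF this] show "bseg B A \<in> B" "init_seg (bseg B A) A"
    unfolding bseg_def by auto
qed

lemma bseg_eq:
  assumes "barrier B" "s \<in> B" "init_seg s A"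
  shows "bseg B A = s"
proof -
  have "\<exists>s. s \<in> B \<and> init_seg s A" using assms by blast
  from someI_ex[OF this] show ?thesis
    unfolding bseg_def using barrier_init_seg_eq[OF assms(1)] assms(2,3) by blast
qed

lemma init_seg_cut:
  assumes "init_seg s A" "\<forall>x\<in>s. x \<le> k" "A' \<inter> {..k} = A \<inter> {..k}"
  shows "init_seg s A'"
proof -
  have *: "x \<in> A' \<longleftrightarrow> x \<in> A" if "x \<le> k" for x using assms(3) that by blast
  show ?thesis
    using assms(1,2) * unfolding init_seg_def by (meson order_trans subset_eq)
qed

lemma locally_constant_bseg:
  assumes "barrier B"
  shows "locally_constant (\<Union>B) (bseg B)"
  unfolding locally_constant_def
proof
  fix A assume A: "A \<in> infsets (\<Union>B)"
  note s = bseg[OF assms A]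
  have "finite (bseg B A)" using s(2) by (simp add: init_seg_def)
  then obtain k where k: "\<forall>x\<in>bseg B A. x \<le> k"
    using finite_nat_set_iff_bounded_le by blast
  have "bseg B A' = bseg B A" if "A' \<inter> {..k} = A \<inter> {..k}" for A'
    using bseg_eq[OF assms s(1) init_seg_cut[OF s(2) k that]] .
  then show "\<exists>k. \<forall>A'\<in>infsets (\<Union>B). A' \<inter> {..k} = A \<inter> {..k} \<longrightarrow> bseg B A' = bseg B A" by blast
qed

lemma init_seg_beyond: "finite s \<Longrightarrow> init_seg s (s \<union> beyond s X)"
  by (force simp: init_seg_def beyond_def)

text \<open>Both \<open>s - {i}\<close> and \<open>t\<close> are initial segments of
  \<open>shift A\<close>, hence comparable. Were \<open>t\<close> the smaller, it would be a proper
  subset of \<open>s\<close>. So \<open>s\<close> is a proper initial segment of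
  \<open>insert i t\<close>, which serves as \<open>r\<close>.\<close>

lemma tri_bseg:
  assumes B: "barrier B" and A: "A \<in> infsets (\<Union>B)"
  shows "tri (bseg B A) (bseg B (shift A))"
proof -
  define s t i where "s = bseg B A" and "t = bseg B (shift A)" and "i = Inf A"
  have s: "s \<in> B" "init_seg s A" using bseg[OF B A] by (auto simp: s_def)
  have t: "t \<in> B" "init_seg t (shift A)" using bseg[OF B shift_infsets[OF A]] by (auto simp: t_def)
  have i: "i \<in> A" "\<And>x. x \<in> A \<Longrightarrow> i \<le> x" using Inf_in_infsets[OF A] Inf_nat_le by (auto simp: i_def)
  have sh: "shift A = A - {i}" by (simp add: shift_def i_def)
  have iins: "i \<in> s" using s i barrier_nonempty[OF B s(1)] unfolding init_seg_def by blast
  have it: "i \<notin> t" using t(2) by (auto simp: init_seg_def sh)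
  have "init_seg (s - {i}) (shift A)" using s(2) by (auto simp: init_seg_def sh)
  then have "s - {i} \<subseteq> t \<or> t \<subseteq> s - {i}" using init_seg_linear t(2) by blast
  moreover have "\<not> t \<subset> s" using B s t by (auto simp: barrier_def)
  ultimately have sub: "s - {i} \<subseteq> t" using iins by blast
  define r where "r = insert i t"
  have fin: "finite r" using t by (simp add: r_def init_seg_def)
  have "Min r = i"
  proof (rule Min_eqI[OF fin])
    show "i \<le> y" if "y \<in> r" for y using that i t(2) by (auto simp: r_def init_seg_def sh)
  qed (simp add: r_def)
  then have "t = r - {Min r}" using it by (auto simp: r_def)
  moreover have "init_seg s r"
  proof -
    have "r \<subseteq> A" using i t(2) by (auto simp: r_def init_seg_def sh)
    then show ?thesis using s(2) sub unfolding init_seg_def r_def by blast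
  qed
  moreover have "s \<noteq> r" using \<open>\<not> t \<subset> s\<close> it by (auto simp: r_def)
  ultimately show ?thesis using fin unfolding tri_def s_def[symmetric] t_def[symmetric]
    by (intro exI[of _ r]) (auto simp: r_def)
qed

text \<open>Converse of \<open>tri_bseg\<close>: prolonging the witness \<open>r\<close> realises a
  related pair by one infinite set and its shift. The exact form of \<open>shift A\<close> depends
  on \<open>t\<close> and \<open>X\<close> only.\<close>

lemma tri_extend:
  assumes "tri s t" "s \<noteq> {}" "s \<subseteq> X" "t \<subseteq> X" "infinite X"
  obtains A where "A \<in> infsets X" "init_seg s A" "shift A = t \<union> beyond t X" "init_seg t (shift A)"
    "Inf A \<in> s"
proof -
  obtain r where r: "finite r" "r \<noteq> {}" "init_seg s r" "s \<noteq> r" "t = r - {Min r}"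
    using assms(1) by (auto simp: tri_def)
  define A where "A = r \<union> beyond r X"
  have Mr: "Min r \<in> r" "\<And>x. x \<in> r \<Longrightarrow> Min r \<le> x" using r by auto
  have Ms: "Min r \<in> s" using Mr r(3) assms(2) unfolding init_seg_def by blast
  have rX: "r \<subseteq> X" using Ms assms(3,4) r(5) by blast
  have "s \<subset> r" using r(3,4) by (auto simp: init_seg_def)
  then obtain y where y: "y \<in> r" "y \<notin> s" by blast
  have yt: "y \<in> t" "Min r < y" using y Ms r(5) Mr(2)[OF y(1)] by (auto simp: le_less)
  \<comment> \<open>\<open>r\<close> has a point \<open>y\<close> outside \<open>s\<close>, above
    the least element of \<open>r\<close>; so adding that least element to \<open>t\<close> does not
    change what lies beyond.\<close>
  have "beyond (insert m t) X = beyond t X" if "m < y" for m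
    using yt(1) that by (auto simp: beyond_def intro: less_trans)
  moreover have "r = insert (Min r) t" using r(5) Mr(1) by blast
  ultimately have bt: "beyond r X = beyond t X" using yt(2) by metis
  have I: "Inf A = Min r"
  proof (rule cInf_eq_minimum)
    show "Min r \<in> A" using Mr by (simp add: A_def)
    show "Min r \<le> x" if "x \<in> A" for x
      using that Mr by (auto simp: A_def beyond_def less_imp_le)
  qed
  have Mb: "Min r \<notin> beyond r X" using Mr(1) by (auto simp: beyond_def)
  have sh: "shift A = t \<union> beyond t X"
    unfolding shift_def I using Mb r(5) bt by (auto simp: A_def)
  have ft: "finite t" using r by simp
  show thesis
  proof (rule that[of A])
    show "A \<in> infsets X"
      using rX beyond_infinite[OF r(1) assms(5)] by (auto simp: A_def infsets_def beyond_def)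
    show "init_seg s A"
      using r(3) unfolding init_seg_def A_def by (auto simp: beyond_def dest: leD)
    show "shift A = t \<union> beyond t X" by (rule sh)
    show "init_seg t (shift A)" unfolding sh by (rule init_seg_beyond[OF ft])
    show "Inf A \<in> s" using Ms by (simp add: I)
  qed
qed

lemma tri_Min_less:
  assumes "barrier B" "s \<in> B" "t \<in> B" "tri s t"
  shows "Min s < Min t"
proof -
  have ne: "s \<noteq> {}" "t \<noteq> {}" using barrier_nonempty assms by blast+
  obtain A where A: "A \<in> infsets (\<Union>B)" "init_seg s A" "init_seg t (shift A)" "Inf A \<in> s"
    by (rule tri_extend[OF assms(4) ne(1), of "\<Union>B"])
      (use assms barrier_Union_infinite in auto)
  have fin: "finite s" "finite t" using A by (auto simp: init_seg_def)
  have "Min t \<in> shift A" using Min_in[OF fin(2) ne(2)] A(3) by (auto simp: init_seg_def)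
  then have "Inf A < Min t" by (auto simp: shift_beyond beyond_def)
  moreover have "Min s \<le> Inf A" using fin A(4) by simp
  ultimately show ?thesis by simp
qed

lemma bad_map_bseg:
  assumes "barrier B" "\<not> good_map B leq f" "A \<in> infsets (\<Union>B)"
  shows "\<not> leq (f (bseg B A)) (f (bseg B (shift A)))"
proof
  assume "leq (f (bseg B A)) (f (bseg B (shift A)))"
  then have "good_map B leq f"
    unfolding good_map_def
    by (intro bexI[of _ "bseg B A"] bexI[of _ "bseg B (shift A)"] conjI tri_bseg bseg(1)
        shift_infsets assms)
  then show False using assms(2) by blast
qed

section \<open>Restriction of a barrier and its order type\<close>

lemma barrier_restrict:
  assumes B: "barrier B" and X: "X \<in> infsets (\<Union>B)"
  shows "barrier {s \<in> B. s \<subseteq> X}"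
  unfolding barrier_def
proof (intro conjI)
  let ?C = "{s \<in> B. s \<subseteq> X}"
  have seg: "\<exists>s\<in>?C. s \<noteq> {} \<and> init_seg s Y" if "Y \<in> infsets X" for Y
  proof -
    have Y: "Y \<in> infsets (\<Union>B)" using infsets_trans[OF that X] .
    have "bseg B Y \<subseteq> X" using bseg(2)[OF B Y] that by (auto simp: init_seg_def infsets_def)
    then show ?thesis using bseg[OF B Y] barrier_nonempty[OF B] by blast
  qed
  show "infinite ?C"
  proof
    \<comment> \<open>The points of \<open>X\<close> past all members of \<open>?C\<close> would
      form an infinite set whose initial segment is again in \<open>?C\<close>.\<close>
    assume fin: "finite ?C"
    have "finite (\<Union>?C)" using fin B by (auto simp: barrier_def)
    then have "beyond (\<Union>?C) X \<in> infsets X"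
      using beyond_infsets[of "\<Union>?C" X X] X by (auto simp: infsets_def)
    then obtain s where s: "s \<in> ?C" "s \<noteq> {}" "init_seg s (beyond (\<Union>?C) X)" using seg by blast
    then obtain x where x: "x \<in> s" by blast
    then have "x \<in> beyond (\<Union>?C) X" "x \<in> \<Union>?C" using s by (auto simp: init_seg_def)
    then show False unfolding beyond_def by blast
  qed
  show "\<forall>s\<in>?C. finite s" "\<forall>s\<in>?C. \<forall>t\<in>?C. \<not> s \<subset> t" using B by (auto simp: barrier_def)
  show "\<forall>Y. Y \<subseteq> \<Union>?C \<and> infinite Y \<longrightarrow> (\<exists>s\<in>?C. s \<noteq> {} \<and> init_seg s Y)"
  proof (intro allI impI)
    fix Y assume Y: "Y \<subseteq> \<Union>?C \<and> infinite Y"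
    then have "Y \<in> infsets X" unfolding infsets_def by blast
    then show "\<exists>s\<in>?C. s \<noteq> {} \<and> init_seg s Y" by (rule seg)
  qed
qed

text \<open>Otherwise \<open>r\<close> is isomorphic to a proper initial segment of its own
  restriction, and the isomorphism \<open>h\<close> moves the bounding point \<open>a\<close>
  strictly down. If \<open>z\<close> is the least point moved down, then \<open>h z\<close> is a
  smaller one.\<close>

lemma Restr_ordLeq:
  assumes r: "Well_order r"
  shows "(Restr r A, r) \<in> ordLeq"
proof (rule ccontr)
  let ?q = "Restr r A"
  have q: "Well_order ?q" using r by (rule Well_order_Restr)
  assume "(?q, r) \<notin> ordLeq"
  then have "(r, ?q) \<in> ordLess" using r q not_ordLeq_iff_ordLess by blast
  then obtain a where a: "a \<in> Field ?q" "(r, Restr ?q (underS ?q a)) \<in> ordIso"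
    using ordLess_iff_ordIso_Restr[OF q r] by blast
  then obtain h where h: "iso r (Restr ?q (underS ?q a)) h" by (auto simp: ordIso_def)
  have inj: "inj_on h (Field r)" using h by (auto simp: iso_def bij_betw_def)
  have hr: "(h x, h y) \<in> r" if "(x, y) \<in> r" for x y using iso_forward[OF that h] by blast
  have "a \<in> Field r" using a(1) by (auto simp: Field_def)
  moreover have "(h a, a) \<in> r \<and> h a \<noteq> a"
  proof -
    have "(a, a) \<in> r" using \<open>a \<in> Field r\<close> r
      by (auto simp: order_on_defs refl_on_def)
    from iso_forward[OF this h] show ?thesis by (auto simp: underS_def)
  qed
  ultimately have mem: "a \<in> {x \<in> Field r. (h x, x) \<in> r \<and> h x \<noteq> x}" by blast
  have "wf (r - Id)" using r by (simp add: well_order_on_def)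
  then obtain z where z: "z \<in> Field r" "(h z, z) \<in> r" "h z \<noteq> z"
    and min: "\<And>y. (y, z) \<in> r - Id \<Longrightarrow> \<not> (y \<in> Field r \<and> (h y, y) \<in> r \<and> h y \<noteq> y)"
    by (rule wfE_min[OF _ mem]) auto
  have hz: "h z \<in> Field r" using z(2) by (auto simp: Field_def)
  have "h (h z) \<noteq> h z" using inj z hz by (meson inj_onD)
  then show False using min[of "h z"] z hz hr[OF z(2)] by blast
qed

lemma lex_barrier_restrict_ordLeq:
  assumes "(lex_barrier B, \<alpha>) \<in> ordLeq"
  shows "(lex_barrier {s \<in> B. s \<subseteq> X}, \<alpha>) \<in> ordLeq"
proof -
  have "lex_barrier {s \<in> B. s \<subseteq> X} = Restr (lex_barrier B) {s. s \<subseteq> X}"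
    unfolding lex_barrier_def by blast
  \<comment> \<open>Contained in the assumed comparison, as \<open>ordLeq\<close> relates
    well-orders only.\<close>
  moreover have "Well_order (lex_barrier B)" using assms ordLeq_Well_order_simp by blast
  ultimately have "(lex_barrier {s \<in> B. s \<subseteq> X}, lex_barrier B) \<in> ordLeq"
    using Restr_ordLeq[of "lex_barrier B" "{s. s \<subseteq> X}"] by simp
  then show ?thesis using assms ordLeq_transitive by blast
qed

lemma alpha_bqo_restrict:
  assumes "alpha_bqo \<alpha> Q leq" "barrier B" "(lex_barrier B, \<alpha>) \<in> ordLeq" "X \<in> infsets (\<Union>B)"
    and "\<And>s. s \<in> B \<Longrightarrow> s \<subseteq> X \<Longrightarrow> g s \<in> Q"
  obtains s t where "s \<in> B" "t \<in> B" "s \<subseteq> X" "t \<subseteq> X" "tri s t" "leq (g s) (g t)"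
proof -
  have "g ` {s \<in> B. s \<subseteq> X} \<subseteq> Q" using assms(5) by blast
  then have "good_map {s \<in> B. s \<subseteq> X} leq g"
    using assms(1) barrier_restrict[OF assms(2,4)] lex_barrier_restrict_ordLeq[OF assms(3), of X]
    unfolding alpha_bqo_def by simp
  then show thesis using that unfolding good_map_def by blast
qed

lemma bad_map_separation:
  assumes po: "poset_on P le" and ac: "\<forall>A. antichain_in P le A \<longrightarrow> finite A"
    and nd: "\<nexists>a. descending P le a"
    and B: "barrier B" and f: "f ` B \<subseteq> P" and bad: "\<not> good_map B le f"
  obtains X g where "X \<in> infsets (\<Union>B)"
    "\<And>s. s \<in> B \<Longrightarrow> s \<subseteq> X \<Longrightarrow> g s \<in> P \<and> strict le (f s) (g s)"
    "\<And>s t. s \<in> B \<Longrightarrow> t \<in> B \<Longrightarrow> s \<subseteq> X \<Longrightarrow> t \<subseteq> X \<Longrightarrow> tri s t \<Longrightarrow> \<not> le (f s) (g t)"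
proof -
  define F where "F A = f (bseg B A)" for A
  have lc: "locally_constant (\<Union>B) F"
    unfolding F_def by (rule locally_constant_comp[OF locally_constant_bseg[OF B]])
  have FP: "F A \<in> P" if "A \<in> infsets (\<Union>B)" for A
    using f bseg(1)[OF B that] by (auto simp: F_def)
  have Fbad: "\<not> le (F A) (F (shift A))" if "A \<in> infsets (\<Union>B)" for A
    using bad_map_bseg[OF B bad that] by (simp add: F_def)
  obtain X m where X: "X \<in> infsets (\<Union>B)"
    and m: "\<And>A. A \<in> infsets X \<Longrightarrow> m A \<in> A"
      "\<And>A. A \<in> infsets X \<Longrightarrow> m A < m (shift A)"
      "\<And>A. A \<in> infsets X \<Longrightarrow> strict le (F A) (F (A - {m A}))"
      "\<And>A A'. A \<in> infsets X \<Longrightarrow> A' \<in> infsets X \<Longrightarrow> A' \<inter> {..m A} = A \<inter> {..m A} \<Longrightarrow> F A' = F A"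
    using bad_continuous_map_removal[OF po ac nd barrier_Union_infinite[OF B] lc FP Fbad] by metis
  have Xinf: "infinite X" using X by (simp add: infsets_def)
  \<comment> \<open>\<open>E s\<close> is a canonical continuation of \<open>s\<close>, chosen so
    that \<open>tri_extend\<close> yields a set whose shift is exactly \<open>E t\<close>.\<close>
  define E where "E s = s \<union> beyond s X" for s
  define g where "g s = F (E s - {m (E s)})" for s
  have rm: "A - {n} \<in> infsets X" if "A \<in> infsets X" for A n
    using that by (auto simp: infsets_def)
  have fin: "finite s" if "s \<in> B" for s using B that by (simp add: barrier_def)
  have E: "E s \<in> infsets X" if "s \<in> B" "s \<subseteq> X" for s
    using that beyond_infinite[OF fin Xinf] beyond_subset[of s X] by (auto simp: E_def infsets_def)
  have fF: "F A = f s" if "s \<in> B" "init_seg s A" for s A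
    using bseg_eq[OF B that] by (simp add: F_def)
  show thesis
  proof (rule that[OF X, of g])
    fix s assume s: "s \<in> B" "s \<subseteq> X"
    have "F (E s) = f s" by (rule fF[OF s(1)]) (simp add: E_def init_seg_beyond[OF fin[OF s(1)]])
    then have "strict le (f s) (g s)" using m(3)[OF E[OF s]] by (simp add: g_def)
    moreover have "g s \<in> P" unfolding g_def by (rule FP[OF infsets_trans[OF rm[OF E[OF s]] X]])
    ultimately show "g s \<in> P \<and> strict le (f s) (g s)" by blast
  next
    fix s t assume s: "s \<in> B" "s \<subseteq> X" and t: "t \<in> B" "t \<subseteq> X" and st: "tri s t"
    obtain A where A: "A \<in> infsets X" "init_seg s A" "shift A = E t"
      using tri_extend[OF st barrier_nonempty[OF B s(1)] s(2) t(2) Xinf] unfolding E_def by metis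
    \<comment> \<open>The depth removed from \<open>E t\<close> lies past \<open>m A\<close>.
      Removing it from \<open>A\<close> therefore leaves the value \<open>f s\<close> unchanged,
      while the value at the shift becomes \<open>g t\<close>; badness at \<open>A - {?n}\<close> is
      the claim.\<close>
    let ?n = "m (E t)"
    have n: "m A < ?n" "?n \<in> shift A" using m(2)[OF A(1)] m(1)[OF E[OF t]] A(3) by simp_all
    have ne: "A \<noteq> {}" "?n \<noteq> Inf A" using n(2) by (auto simp: shift_def)
    have "Inf (A - {?n}) = Inf A"
      using Inf_nat_def1[OF ne(1)] ne(2) Inf_nat_le[of _ A] by (intro cInf_eq_minimum) auto
    then have sh: "shift (A - {?n}) = E t - {?n}" unfolding A(3)[symmetric] by (auto simp: shift_def)
    have "(A - {?n}) \<inter> {..m A} = A \<inter> {..m A}" using n(1) by auto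
    then have "F (A - {?n}) = F A" by (rule m(4)[OF A(1) rm[OF A(1)]])
    then have "F (A - {?n}) = f s" using fF[OF s(1) A(2)] by simp
    then show "\<not> le (f s) (g t)"
      using Fbad[OF infsets_trans[OF rm[OF A(1)] X], of ?n] unfolding g_def sh by simp
  qed
qed

section \<open>Transfer of \<alpha>-bqo to weaker relations and to sequences\<close>

lemma alpha_bqoI:
  assumes "\<And>B f. barrier B \<Longrightarrow> (lex_barrier B, \<alpha>) \<in> ordLeq \<Longrightarrow> f ` B \<subseteq> Q \<Longrightarrow>
    \<not> good_map B leq f \<Longrightarrow> False"
  shows "alpha_bqo \<alpha> Q leq"
  using assms unfolding alpha_bqo_def by blast

lemma alpha_bqo_weaken:
  assumes "alpha_bqo \<alpha> Q leq" "\<And>x y. x \<in> Q \<Longrightarrow> y \<in> Q \<Longrightarrow> leq x y \<Longrightarrow> leq' x y"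
  shows "alpha_bqo \<alpha> Q leq'"
proof (rule alpha_bqoI)
  fix B f assume B: "barrier B" "(lex_barrier B, \<alpha>) \<in> ordLeq" "f ` B \<subseteq> Q" and bad: "\<not> good_map B leq' f"
  have "good_map B leq f" using assms(1) B by (simp add: alpha_bqo_def)
  then obtain s t where st: "s \<in> B" "t \<in> B" "tri s t" "leq (f s) (f t)"
    by (auto simp: good_map_def)
  then have "leq' (f s) (f t)" using assms(2) B(3) by blast
  then show False using bad st by (auto simp: good_map_def)
qed

text \<open>A sequence is read along least elements of barrier members; \<open>tri\<close> raises
  the least element, so a good pair gives \<open>i < j\<close>.\<close>

lemma alpha_bqo_good_sequence:
  assumes "alpha_bqo \<alpha> Q leq" "barrier B" "(lex_barrier B, \<alpha>) \<in> ordLeq"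
    and "\<And>n. c n \<in> Q"
  obtains i j :: nat where "i < j" "leq (c i) (c j)"
proof -
  have "(\<lambda>s. c (Min s)) ` B \<subseteq> Q" using assms(4) by blast
  then have "good_map B leq (\<lambda>s. c (Min s))" using assms(1-3) by (simp add: alpha_bqo_def)
  then show thesis using that tri_Min_less[OF assms(2)] unfolding good_map_def by blast
qed

section \<open>Critical quasi-orders\<close>

lemma le_imp_le_crit:
  assumes "poset_on P le" "a \<in> P" "b \<in> P" "le a b"
  shows "le_crit P le a b"
  unfolding le_crit_def le_pred_def le_succ_def
  using strict_le_trans[OF assms(1)] le_strict_trans[OF assms(1)] assms(2-4) by blast

text \<open>\<open>a j\<close> lies strictly below \<open>a i\<close> but not strictly below
  itself.\<close>

lemma descending_not_le_pred:
  assumes "poset_on P le" "descending P le a" "i < j"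
  shows "\<not> le_pred P le (a i) (a j)"
  using descending_less[OF assms] assms(2) by (auto simp: le_pred_def descending_def strict_def)

lemma descending_not_le_succ:
  assumes "poset_on P le" "descending P le a" "i < j"
  shows "\<not> le_succ P le (a i) (a j)"
  using descending_less[OF assms] assms(2) by (auto simp: le_succ_def descending_def strict_def)

text \<open>The map \<open>g\<close> is bad for \<open>le_pred\<close>: from
  \<open>f s < g s\<close> and \<open>g s\<close> below \<open>g t\<close> in \<open>le_pred\<close>
  would follow \<open>f s < g t\<close>, which the separation forbids.\<close>

lemma alpha_bqo_from_pred:
  assumes po: "poset_on P le" and ac: "\<forall>A. antichain_in P le A \<longrightarrow> finite A"
    and bqo: "alpha_bqo \<alpha> P (le_pred P le)"
  shows "alpha_bqo \<alpha> P le"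
proof (rule alpha_bqoI)
  fix B f assume B: "barrier B" "(lex_barrier B, \<alpha>) \<in> ordLeq"
    and f: "f ` B \<subseteq> P" and bad: "\<not> good_map B le f"
  \<comment> \<open>A barrier of admissible order type is at hand, so a descending chain read along
    it would be a bad map.\<close>
  have nd: "\<nexists>a. descending P le a"
  proof
    assume "\<exists>a. descending P le a"
    then obtain a where a: "descending P le a" by blast
    then have "\<And>n. a n \<in> P" by (simp add: descending_def)
    then show False
      using alpha_bqo_good_sequence[OF bqo B] descending_not_le_pred[OF po a] by metis
  qed
  obtain X g where X: "X \<in> infsets (\<Union>B)"
    and g: "\<And>s. s \<in> B \<Longrightarrow> s \<subseteq> X \<Longrightarrow> g s \<in> P \<and> strict le (f s) (g s)"
    and fg: "\<And>s t. s \<in> B \<Longrightarrow> t \<in> B \<Longrightarrow> s \<subseteq> X \<Longrightarrow> t \<subseteq> X \<Longrightarrow> tri s t \<Longrightarrow> \<not> le (f s) (g t)"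
    using bad_map_separation[OF po ac nd B(1) f bad] by metis
  obtain s t where st: "s \<in> B" "t \<in> B" "s \<subseteq> X" "t \<subseteq> X" "tri s t" "le_pred P le (g s) (g t)"
    by (rule alpha_bqo_restrict[OF bqo B X, of g]) (use g in auto)
  have "f s \<in> P" using f st(1) by blast
  then have "strict le (f s) (g t)" using st(6) g[OF st(1,3)] by (simp add: le_pred_def)
  then show False using fg[OF st(1-5)] by (simp add: strict_def)
qed

text \<open>Here \<open>f\<close> itself, restricted, is bad for \<open>le_succ\<close>: from
  \<open>f t < g t\<close> and \<open>f s\<close> below \<open>f t\<close> in \<open>le_succ\<close>
  would follow \<open>f s < g t\<close>.\<close>

lemma alpha_bqo_from_succ:
  assumes po: "poset_on P le" and ac: "\<forall>A. antichain_in P le A \<longrightarrow> finite A"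
    and bqo: "alpha_bqo \<alpha> P (le_succ P le)"
  shows "alpha_bqo \<alpha> P le"
proof (rule alpha_bqoI)
  fix B f assume B: "barrier B" "(lex_barrier B, \<alpha>) \<in> ordLeq"
    and f: "f ` B \<subseteq> P" and bad: "\<not> good_map B le f"
  have nd: "\<nexists>a. descending P le a"
  proof
    assume "\<exists>a. descending P le a"
    then obtain a where a: "descending P le a" by blast
    then have "\<And>n. a n \<in> P" by (simp add: descending_def)
    then show False
      using alpha_bqo_good_sequence[OF bqo B] descending_not_le_succ[OF po a] by metis
  qed
  obtain X g where X: "X \<in> infsets (\<Union>B)"
    and g: "\<And>s. s \<in> B \<Longrightarrow> s \<subseteq> X \<Longrightarrow> g s \<in> P \<and> strict le (f s) (g s)"
    and fg: "\<And>s t. s \<in> B \<Longrightarrow> t \<in> B \<Longrightarrow> s \<subseteq> X \<Longrightarrow> t \<subseteq> X \<Longrightarrow> tri s t \<Longrightarrow> \<not> le (f s) (g t)"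
    using bad_map_separation[OF po ac nd B(1) f bad] by metis
  obtain s t where st: "s \<in> B" "t \<in> B" "s \<subseteq> X" "t \<subseteq> X" "tri s t" "le_succ P le (f s) (f t)"
    by (rule alpha_bqo_restrict[OF bqo B X, of f]) (use f in auto)
  have "strict le (f s) (g t)" using st(6) g[OF st(2,4)] by (simp add: le_succ_def)
  then show False using fg[OF st(1-5)] by (simp add: strict_def)
qed

section \<open>Maximal antichains\<close>

definition min_antichain :: "'p set \<Rightarrow> ('p \<Rightarrow> 'p \<Rightarrow> bool) \<Rightarrow> 'p \<Rightarrow> 'p set" where
  "min_antichain P le a = insert a {y \<in> P. \<not> le a y \<and> \<not> le y a \<and>
     (\<forall>z\<in>P. strict le z y \<longrightarrow> le a z \<or> le z a)}"

lemma minimal_below: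
  assumes po: "poset_on P le" and nd: "\<nexists>a. descending P le a" and S: "S \<subseteq> P" "x \<in> S"
  obtains q where "q \<in> S" "le q x" "\<And>z. z \<in> S \<Longrightarrow> \<not> strict le z q"
proof -
  let ?r = "{(y, x). x \<in> P \<and> y \<in> P \<and> strict le y x}"
  have wf: "wf ?r"
    unfolding wf_iff_no_infinite_down_chain
  proof
    assume "\<exists>a. \<forall>i. (a (Suc i), a i) \<in> ?r"
    then obtain a where "\<forall>i. (a (Suc i), a i) \<in> ?r" by blast
    then have "descending P le a" by (simp add: descending_def)
    then show False using nd by blast
  qed
  have "x \<in> {y \<in> S. le y x}" using S poset_onD(1)[OF po, of x] by blast
  then obtain q where q: "q \<in> {y \<in> S. le y x}"
    and min: "\<And>y. (y, q) \<in> ?r \<Longrightarrow> y \<notin> {y \<in> S. le y x}"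
    by (rule wfE_min[OF wf]) auto
  have "\<not> strict le z q" if z: "z \<in> S" for z
  proof
    assume zq: "strict le z q"
    have P: "z \<in> P" "q \<in> P" "x \<in> P" using z q S by auto
    then have "le z x" using strict_le_trans[OF po P zq] q by (simp add: strict_def)
    then show False using min[of z] z zq P by simp
  qed
  then show thesis using that[of q] q by simp
qed

lemma min_antichain_below:
  assumes po: "poset_on P le" and nd: "\<nexists>a. descending P le a"
    and x: "x \<in> P" "\<not> le a x" "\<not> le x a"
  obtains q where "q \<in> min_antichain P le a" "le q x"
proof -
  let ?S = "{y \<in> P. \<not> le a y \<and> \<not> le y a}"
  obtain q where "q \<in> ?S" "le q x" "\<And>z. z \<in> ?S \<Longrightarrow> \<not> strict le z q"
    by (rule minimal_below[OF po nd, of ?S x]) (use x in auto)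
  then show thesis using that[of q] by (auto simp: min_antichain_def)
qed

text \<open>By well-foundedness each point incomparable to \<open>a\<close> lies above a member, so
  an antichain containing all members can contain such a point only if it is that member.\<close>

lemma min_antichain_AM:
  assumes po: "poset_on P le" and nd: "\<nexists>a. descending P le a" and a: "a \<in> P"
  shows "min_antichain P le a \<in> AM P le"
proof -
  let ?M = "min_antichain P le a"
  have anti: "antichain_in P le ?M"
    using a by (auto simp: antichain_in_def min_antichain_def strict_def)
  have "C = ?M" if C: "antichain_in P le C" "?M \<subseteq> C" for C
  proof
    show "C \<subseteq> ?M"
    proof
      fix z assume z: "z \<in> C"
      have aC: "a \<in> C" using C(2) by (auto simp: min_antichain_def)
      show "z \<in> ?M"
      proof (cases "z = a")
        case True
        then show ?thesis by (simp add: min_antichain_def)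
      next
        case False
        then have inc: "\<not> le a z" "\<not> le z a" "z \<in> P"
          using C(1) z aC by (auto simp: antichain_in_def)
        obtain q where q: "q \<in> ?M" "le q z" by (rule min_antichain_below[OF po nd inc(3,1,2)])
        then have "q \<in> C" using C(2) by blast
        then have "q = z" using C(1) z q(2) by (auto simp: antichain_in_def)
        then show ?thesis using q by simp
      qed
    qed
  qed (rule C(2))
  then show ?thesis using anti unfolding AM_def max_antichain_in_def by blast
qed

text \<open>Let \<open>x < a\<close>, and let \<open>y\<close> dominate \<open>a\<close>, so
  \<open>x < y\<close>. If \<open>x\<close> is not strictly below \<open>b\<close>, some member
  \<open>q\<close> of the antichain of \<open>b\<close> lies below \<open>x\<close>:
  \<open>b\<close> itself, or a minimal element incomparable to \<open>b\<close>. Then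
  \<open>q < y\<close> inside an antichain.\<close>

lemma min_antichain_reflects_pred:
  assumes po: "poset_on P le" and nd: "\<nexists>a. descending P le a" and ab: "a \<in> P" "b \<in> P"
    and dom: "dom_le le (min_antichain P le a) (min_antichain P le b)"
  shows "le_pred P le a b"
  unfolding le_pred_def
proof (intro ballI impI, rule ccontr)
  fix x assume x: "x \<in> P" "strict le x a" and nx: "\<not> strict le x b"
  have "antichain_in P le (min_antichain P le b)"
    using min_antichain_AM[OF po nd ab(2)] by (simp add: AM_def max_antichain_in_def)
  then have anti: "\<And>p q. p \<in> min_antichain P le b \<Longrightarrow> q \<in> min_antichain P le b \<Longrightarrow> \<not> strict le p q"
    and sub: "min_antichain P le b \<subseteq> P"
    unfolding antichain_in_def strict_def by blast+
  obtain y where y: "y \<in> min_antichain P le b" "le a y"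
    using dom unfolding dom_le_def by (auto simp: min_antichain_def)
  have yP: "y \<in> P" using y sub by blast
  have xy: "strict le x y" using strict_le_trans[OF po x(1) ab(1) yP x(2) y(2)] .
  obtain q where q: "q \<in> min_antichain P le b" "le q x"
  proof (cases "le b x \<or> le x b")
    case True
    then have "le b x" using nx poset_onD(1)[OF po ab(2)] by (auto simp: strict_def)
    then show thesis using that[of b] by (simp add: min_antichain_def)
  next
    case False
    then show thesis using min_antichain_below[OF po nd x(1), of b] that by blast
  qed
  have "q \<in> P" using q sub by blast
  then have "strict le q y" using le_strict_trans[OF po _ x(1) yP q(2) xy] by blast
  then show False using anti q y by blast
qed

text \<open>By Zorn's lemma, so that it applies before descending chains are excluded.\<close>

lemma max_antichain_containing:
  assumes "a \<in> P"
  obtains M where "M \<in> AM P le" "a \<in> M"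
proof -
  let ?A = "{M. antichain_in P le M \<and> a \<in> M}"
  have "\<exists>M\<in>?A. \<forall>C\<in>?A. M \<subseteq> C \<longrightarrow> C = M"
  proof (rule subset_Zorn_nonempty)
    have "{a} \<in> ?A" using assms by (auto simp: antichain_in_def)
    then show "?A \<noteq> {}" by blast
    fix \<C> assume ne: "\<C> \<noteq> {}" and ch: "subset.chain ?A \<C>"
    have C: "\<And>M. M \<in> \<C> \<Longrightarrow> antichain_in P le M \<and> a \<in> M"
      and lin: "\<And>M N. M \<in> \<C> \<Longrightarrow> N \<in> \<C> \<Longrightarrow> M \<subseteq> N \<or> N \<subseteq> M"
      using ch unfolding subset_chain_def by auto
    have "\<not> le x y" if xy: "x \<in> \<Union>\<C>" "y \<in> \<Union>\<C>" "x \<noteq> y" for x y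
    proof -
      obtain M N where "M \<in> \<C>" "N \<in> \<C>" "x \<in> M" "y \<in> N" using xy by blast
      then obtain K where "K \<in> \<C>" "x \<in> K" "y \<in> K" using lin[of M N] by blast
      then show ?thesis using C[of K] xy(3) unfolding antichain_in_def by blast
    qed
    moreover have "\<Union>\<C> \<subseteq> P" using C unfolding antichain_in_def by blast
    moreover have "a \<in> \<Union>\<C>" using ne C by blast
    ultimately show "\<Union>\<C> \<in> ?A" by (simp add: antichain_in_def)
  qed
  then obtain M where M: "antichain_in P le M" "a \<in> M"
    and max: "\<And>C. antichain_in P le C \<Longrightarrow> a \<in> C \<Longrightarrow> M \<subseteq> C \<Longrightarrow> C = M" by blast
  have "M \<in> AM P le" using M max unfolding AM_def max_antichain_in_def by blast
  then show thesis using that M by blast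
qed

lemma alpha_bqo_pred_from_AM:
  assumes po: "poset_on P le" and bqo: "alpha_bqo \<alpha> (AM P le) (dom_le le)"
  shows "alpha_bqo \<alpha> P (le_pred P le)"
proof (rule alpha_bqoI)
  fix B f assume B: "barrier B" "(lex_barrier B, \<alpha>) \<in> ordLeq"
    and f: "f ` B \<subseteq> P" and bad: "\<not> good_map B (le_pred P le) f"
  \<comment> \<open>Choose maximal antichains \<open>M n\<close> through \<open>a n\<close>. If
    \<open>M j\<close> dominates \<open>M i\<close> with \<open>i < j\<close>, some \<open>y\<close>
    in \<open>M j\<close> is above \<open>a i\<close>, hence strictly above \<open>a j\<close>, also
    in \<open>M j\<close>.\<close>
  have nd: "\<nexists>a. descending P le a"
  proof
    assume "\<exists>a. descending P le a"
    then obtain a where a: "descending P le a" by blast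
    then have aP: "\<And>n. a n \<in> P" by (simp add: descending_def)
    have "\<forall>n. \<exists>M. M \<in> AM P le \<and> a n \<in> M" using max_antichain_containing[OF aP] by metis
    then obtain M where M: "\<And>n. M n \<in> AM P le" "\<And>n. a n \<in> M n" by metis
    obtain i j where ij: "i < j" "dom_le le (M i) (M j)"
      by (rule alpha_bqo_good_sequence[OF bqo B, of M]) (use M in auto)
    obtain y where y: "y \<in> M j" "le (a i) y" using ij(2) M(2) unfolding dom_le_def by blast
    have anti: "antichain_in P le (M j)" using M(1)[of j] by (simp add: AM_def max_antichain_in_def)
    then have "y \<in> P" using y(1) by (auto simp: antichain_in_def)
    then have "strict le (a j) y"
      using strict_le_trans[OF po aP aP _ descending_less[OF po a ij(1)] y(2)] by blast
    then show False using anti M(2) y(1) by (auto simp: antichain_in_def strict_def)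
  qed
  have "(\<lambda>s. min_antichain P le (f s)) ` B \<subseteq> AM P le" using f min_antichain_AM[OF po nd] by blast
  then have "good_map B (dom_le le) (\<lambda>s. min_antichain P le (f s))"
    using bqo B by (simp add: alpha_bqo_def)
  then obtain s t where st: "s \<in> B" "t \<in> B" "tri s t"
    "dom_le le (min_antichain P le (f s)) (min_antichain P le (f t))"
    by (auto simp: good_map_def)
  then have "f s \<in> P" "f t \<in> P" using f by auto
  then have "le_pred P le (f s) (f t)" using min_antichain_reflects_pred[OF po nd _ _ st(4)] by blast
  then show False using bad st by (auto simp: good_map_def)
qed

text \<open>Badness gives for each related pair \<open>s\<close>, \<open>t\<close> an element of
  \<open>f s\<close> below nothing in \<open>f t\<close>, but it may depend on \<open>t\<close>. As
  \<open>f s\<close> is finite, Ramsey makes one element work for all continuations of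
  \<open>s\<close>, and fusion does so for all \<open>s\<close> together. The chosen elements form a
  bad map into \<open>P\<close>.\<close>

lemma alpha_bqo_finite_subsets:
  assumes bqo: "alpha_bqo \<alpha> P le"
    and S: "\<And>M. M \<in> S \<Longrightarrow> finite M \<and> M \<subseteq> P"
  shows "alpha_bqo \<alpha> S (dom_le le)"
proof (rule alpha_bqoI)
  fix B f assume B: "barrier B" "(lex_barrier B, \<alpha>) \<in> ordLeq"
    and f: "f ` B \<subseteq> S" and bad: "\<not> good_map B (dom_le le) f"
  let ?U = "\<Union>B"
  \<comment> \<open>For \<open>A\<close> past a barrier member \<open>u\<close>, the set
    \<open>bseg B (shift (u \<union> A))\<close> is a successor of \<open>u\<close> under
    \<open>tri\<close>.\<close>
  define c where "c u x A \<longleftrightarrow> (\<forall>y\<in>f (bseg B (shift (u \<union> A))). \<not> le x y)" for u x A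
  define D where "D u Y \<longleftrightarrow> u \<in> B \<longrightarrow> (\<exists>x\<in>f u. \<forall>A\<in>infsets (beyond u Y). c u x A)" for u Y
  obtain Y where Y: "Y \<in> infsets ?U" "\<And>u. finite u \<Longrightarrow> u \<subseteq> Y \<Longrightarrow> D u (beyond u Y)"
  proof (rule fusion[of D ?U])
    show "D u Z" if D: "D u Y" and Z: "Z \<in> infsets Y" for u Y Z
    proof -
      have "beyond u Z \<subseteq> beyond u Y" using Z by (intro beyond_mono) (simp add: infsets_def)
      then show ?thesis using D infsets_mono[of _ "beyond u Z" "beyond u Y"] unfolding D_def by meson
    qed
    show "infinite ?U" by (rule barrier_Union_infinite[OF B(1)])
    show "\<exists>Z\<in>infsets Y. D u Z" if u: "finite u" "u \<subseteq> ?U" and Y: "Y \<in> infsets ?U" for u Y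
    proof (cases "u \<in> B")
      case False
      then show ?thesis using Y by (auto simp: D_def infsets_def)
    next
      case True
      have bY: "beyond u Y \<subseteq> ?U" "infinite (beyond u Y)"
        using beyond_infsets[OF u(1) Y] by (auto simp: infsets_def)
      have "locally_constant ?U (c u x)" for x
        unfolding c_def
        by (rule locally_constant_comp[OF locally_constant_union[OF
              locally_constant_shift[OF locally_constant_bseg[OF B(1)]] u(2,1)]])
      then have lc: "locally_constant (beyond u Y) (c u x)" for x
        using locally_constant_subset bY(1) by blast
      have "finite (f u)" using S f True by blast
      then obtain Z where Z: "Z \<in> infsets (beyond u Y)"
        "\<And>x. x \<in> f u \<Longrightarrow> (\<forall>A\<in>infsets Z. c u x A) \<or> (\<forall>A\<in>infsets Z. \<not> c u x A)"
        by (rule clopen_Ramsey_family[of "f u" "beyond u Y" "c u"]) (use lc bY(2) in auto)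
      have ZZ: "Z \<in> infsets Z" using Z(1) by (auto simp: infsets_def)
      have seg: "init_seg u (u \<union> Z)"
        using u(1) Z(1) by (force simp: init_seg_def infsets_def beyond_def)
      have uZ: "u \<union> Z \<in> infsets ?U" using u(2) Z(1) bY(1) by (auto simp: infsets_def)
      have "\<not> dom_le le (f u) (f (bseg B (shift (u \<union> Z))))"
        using bad_map_bseg[OF B(1) bad uZ] bseg_eq[OF B(1) True seg] by simp
      \<comment> \<open>Badness at the single continuation \<open>Z\<close> names an
        \<open>x\<close>; homogeneity extends it to all of \<open>infsets Z\<close>.\<close>
      then obtain x where x: "x \<in> f u" "c u x Z" by (auto simp: dom_le_def c_def)
      then have all: "\<forall>A\<in>infsets Z. c u x A" using Z(2) ZZ by blast
      have "D u Z" unfolding D_def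
        using x(1) all infsets_mono[OF _ beyond_subset] by blast
      moreover have "Z \<in> infsets Y" using Z(1) infsets_mono beyond_subset by blast
      ultimately show ?thesis by blast
    qed
  qed auto
  have fin: "finite s" if "s \<in> B" for s using B(1) that by (simp add: barrier_def)
  have idem: "beyond u (beyond u Y) = beyond u Y" for u by (auto simp: beyond_def)
  have "\<exists>x. x \<in> f s \<and> (\<forall>A\<in>infsets (beyond s Y). c s x A)" if "s \<in> B" "s \<subseteq> Y" for s
    using Y(2)[OF fin[OF that(1)] that(2)] that(1) unfolding D_def idem by blast
  then obtain g where g: "\<And>s. s \<in> B \<Longrightarrow> s \<subseteq> Y \<Longrightarrow> g s \<in> f s"
    "\<And>s A. s \<in> B \<Longrightarrow> s \<subseteq> Y \<Longrightarrow> A \<in> infsets (beyond s Y) \<Longrightarrow> c s (g s) A" by metis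
  obtain s t where st: "s \<in> B" "t \<in> B" "s \<subseteq> Y" "t \<subseteq> Y" "tri s t" "le (g s) (g t)"
    by (rule alpha_bqo_restrict[OF bqo B Y(1), of g]) (use g(1) S f in blast)+
  have Yinf: "infinite Y" using Y(1) by (simp add: infsets_def)
  obtain A where A: "A \<in> infsets Y" "init_seg s A" "init_seg t (shift A)"
    by (rule tri_extend[OF st(5) barrier_nonempty[OF B(1) st(1)] st(3,4) Yinf])
  \<comment> \<open>\<open>A\<close> realises the pair \<open>s\<close>, \<open>t\<close>, so its
    tail \<open>A - s\<close> is a continuation at which \<open>c\<close> speaks about
    \<open>f t\<close>.\<close>
  have "infinite (A - s)" using A(1) fin[OF st(1)] by (simp add: infsets_def)
  moreover have "A - s \<subseteq> beyond s Y"
    using A(1,2) unfolding init_seg_def infsets_def beyond_def by (auto simp: not_less[symmetric])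
  ultimately have "c s (g s) (A - s)" using g(2) st(1,3) by (simp add: infsets_def)
  moreover have "s \<union> (A - s) = A" using A(2) by (auto simp: init_seg_def)
  ultimately have "\<forall>y\<in>f t. \<not> le (g s) y" using bseg_eq[OF B(1) st(2) A(3)] by (simp add: c_def)
  then show False using st(6) g(1)[OF st(2,4)] by blast
qed

theorem theorem5p5:
  fixes P :: "'p set" and le :: "'p \<Rightarrow> 'p \<Rightarrow> bool" and \<alpha> :: "'a rel"
  assumes "poset_on P le"
    and "\<forall>A. antichain_in P le A \<longrightarrow> finite A"
    and "Well_order \<alpha>" and "countable (Field \<alpha>)"
  shows "(alpha_bqo \<alpha> P le \<longleftrightarrow> alpha_bqo \<alpha> P (le_succ P le))
       \<and> (alpha_bqo \<alpha> P le \<longleftrightarrow> alpha_bqo \<alpha> P (le_pred P le))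
       \<and> (alpha_bqo \<alpha> P le \<longleftrightarrow> alpha_bqo \<alpha> P (le_crit P le))
       \<and> (alpha_bqo \<alpha> P le \<longleftrightarrow> alpha_bqo \<alpha> (AM P le) (dom_le le))"
proof -
  have crit: "alpha_bqo \<alpha> P (le_crit P le)" if "alpha_bqo \<alpha> P le"
    using alpha_bqo_weaken[OF that] le_imp_le_crit[OF assms(1)] by blast
  have pred: "alpha_bqo \<alpha> P (le_pred P le)" if "alpha_bqo \<alpha> P (le_crit P le)"
    by (rule alpha_bqo_weaken[OF that]) (simp add: le_crit_def)
  have succ: "alpha_bqo \<alpha> P (le_succ P le)" if "alpha_bqo \<alpha> P (le_crit P le)"
    by (rule alpha_bqo_weaken[OF that]) (simp add: le_crit_def)
  have AM: "alpha_bqo \<alpha> (AM P le) (dom_le le)" if "alpha_bqo \<alpha> P le"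
    by (rule alpha_bqo_finite_subsets[OF that])
      (use assms(2) in \<open>auto simp: AM_def max_antichain_in_def antichain_in_def\<close>)
  \<comment> \<open>The implications close up: \<open>le\<close> gives \<open>le_crit\<close>, which
    gives \<open>le_pred\<close> and \<open>le_succ\<close>, and each of these returns to
    \<open>le\<close>; moreover \<open>le\<close> gives \<open>AM\<close>, which gives
    \<open>le_pred\<close>.\<close>
  show ?thesis
    using crit pred succ AM alpha_bqo_from_pred[OF assms(1,2)] alpha_bqo_from_succ[OF assms(1,2)]
      alpha_bqo_pred_from_AM[OF assms(1)] by blast
qed

end
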